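(* Fix $0<p<1$. For $r,s>0$ let $$N(r,s)=\#\{(j,k)\in\mathbb{N}\times\mathbb{N}:(js)^p+(ks^{-1})^p\le r^p\},$$ and let $S(r)=\operatorname{argmax}_{s>0}N(r,s)$ be the set of $s>0$ maximizing $s\mapsto N(r,s)$. Let $e=\min\{\tfrac16,\tfrac p2\}$. Then, as $r\to\infty$, $$S(r)\subset\left[1-O(r^{-e}),\,1+O(r^{-e})\right],$$ that is, there are constants $C,r_0>0$ (depending on $p$) such that $|s-1|\le Cr^{-e}$ for all $r\ge r_0$ and all $s\in S(r)$. (Thus the $p$-ellipse $|sx|^p+|s^{-1}y|^p\le r^p$ containing the maximum number of positive-integer lattice points must approach a $p$-circle in the limit as $r\to\infty$.)
   Context: $\mathbb{N}=\{1,2,3,\dots\}$. $N(r,s)$ counts the positive-integer lattice points inside or on the $p$-ellipse $|sx|^p+|s^{-1}y|^p=r^p$; the $p$-circle is the case $s=1$. *)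

theory Defs
  imports "HOL-Analysis.Analysis"
begin

text \<open>For \<open>p, r, s > 0\<close> the counted set is finite (\<open>j \<le> r / s\<close> and \<open>k \<le> r * s\<close>),
  so \<^const>\<open>card\<close> is the true number of points.\<close>

definition lattice_count :: "real \<Rightarrow> real \<Rightarrow> real \<Rightarrow> nat" where
  "lattice_count p r s =
     card {(j, k). 1 \<le> j \<and> 1 \<le> k \<and>
       (real (j::nat) * s) powr p + (real (k::nat) * inverse s) powr p \<le> r powr p}"

definition optimal_stretches :: "real \<Rightarrow> real \<Rightarrow> real set" where
  "optimal_stretches p r = {s. is_arg_max (lattice_count p r) (\<lambda>s. 0 < s) s}"

end

theory Submission
  imports Defs
begin

text \<open>Write \<open>f x = (1 - x\<^sup>p)\<^bsup>1/p\<^esup>\<close>, \<open>R = r / s\<close>, \<open>S = r s\<close>, and cut the region at the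
  diagonal point \<open>\<alpha> = f \<alpha>\<close>. The number of lattice points is a sum of floors of \<open>S f(j/R)\<close>
  over \<open>j \<le> \<alpha> R\<close>, plus the same sum with \<open>R\<close> and \<open>S\<close> exchanged, minus the common rectangle.
  The trapezoidal rule gives the smooth parts up to \<open>O(r\<^bsup>1-p\<^esup>)\<close>, the vertical tangent at 0 being
  the worst place; van der Corput's second derivative test bounds the sawtooth parts by
  \<open>O(r\<^bsup>2/3\<^esup>)\<close>. Hence, for \<open>s\<close> in a bounded range,
  \<open>N(r,s) = c r\<^sup>2 - r (s + 1/s) / 2 + O(r\<^bsup>1-2e\<^esup>)\<close>, and \<open>N(r,s) \<ge> N(r,1)\<close> forces
  \<open>s + 1/s - 2 = O(r\<^bsup>-2e\<^esup>)\<close>. That maximizing \<open>s\<close> stay bounded follows from cruder one-sided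
  estimates: the trapezoidal rule if \<open>R\<close> is large, and the area lost in the first column otherwise.\<close>

section \<open>Exponential sums\<close>

text \<open>Cutting at the diagonal keeps both halves away from the flat end x = 1 and makes them
  one problem up to swapping R and S. The price is the fractional parts of \<alpha> R and \<alpha>
  S, but their first-order contributions to the two sums cancel against the rectangle
  (\<open>main_term\<close>), leaving O(1). The Fourier series of the sawtooth converges only
  conditionally, so the sawtooth is squeezed between difference quotients of its antiderivative, the
  periodic second Bernoulli polynomial, whose series converges absolutely; the step 1/H is then
  tuned to the curvature. The second derivative test is stated for second differences, so the second
  derivative of f never appears. The exponent: r^(2/3) and r^(1-p) are both at most r^(1-2e), and s
  + 1/s has a quadratic minimum at 1, so dividing by r and taking a square root leaves r^(-e). The
  expansion needs R and S comparable. Boundedness of s therefore needs its own argument, with upper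
  bounds for N(r,s) that involve no exponential sum.\<close>

lemma abel_summation_quotients:
  fixes E c :: "nat \<Rightarrow> complex"
  assumes "a < b" and "\<And>n. a \<le> n \<Longrightarrow> n < b \<Longrightarrow> E n = c n * (E n - E (Suc n))"
  shows "(\<Sum>n\<in>{a..<b}. E n) =
    c a * E a - c (b - 1) * E b + (\<Sum>n\<in>{Suc a..<b}. (c n - c (n - 1)) * E n)"
  using assms
proof (induction b)
  case 0
  then show ?case by simp
next
  case (Suc b)
  show ?case
  proof (cases "a = b")
    case True
    then show ?thesis using Suc.prems(2)[of a] by (simp add: algebra_simps)
  next
    case False
    with Suc.prems(1) have ab: "a < b" by simp
    have IH: "(\<Sum>n\<in>{a..<b}. E n) =
      c a * E a - c (b - 1) * E b + (\<Sum>n\<in>{Suc a..<b}. (c n - c (n - 1)) * E n)"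
      by (rule Suc.IH) (use ab Suc.prems in auto)
    have "E b = c b * (E b - E (Suc b))" using Suc.prems(2)[of b] ab by auto
    then show ?thesis using IH ab by (simp add: algebra_simps)
  qed
qed

text \<open>Sine is concave on [0, pi/2], hence above its chord there; the other half follows by
  reflection at 1/2.\<close>

lemma sin_ge_two_mul:
  fixes t x :: real
  assumes "0 < t" "t \<le> x" "x \<le> 1 - t"
  shows "sin (pi * x) \<ge> 2 * t"
proof -
  have key: "sin (pi * y) \<ge> 2 * y" if "0 \<le> y" "y \<le> 1/2" for y :: real
  proof -
    have "concave_on {0..pi/2} sin"
    proof (rule f''_le0_imp_concave)
      fix x :: real assume "x \<in> {0..pi/2}"
      show "(sin has_real_derivative cos x) (at x)" by (auto intro!: derivative_eq_intros)
      show "(cos has_real_derivative - sin x) (at x)" by (auto intro!: derivative_eq_intros)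
      show "- sin x \<le> 0" using \<open>x \<in> {0..pi/2}\<close> sin_ge_zero[of x] pi_gt_zero by auto
    qed auto
    from concave_onD[OF this, of "2*y" 0 "pi/2"] that
    show ?thesis by (simp add: mult.commute)
  qed
  show ?thesis
  proof (cases "x \<le> 1/2")
    case True
    then show ?thesis using key[of x] assms by linarith
  next
    case False
    have "sin (pi * (1 - x)) = sin (pi * x)" by (simp add: algebra_simps sin_diff)
    moreover have "sin (pi * (1 - x)) \<ge> 2 * (1 - x)" using assms False by (intro key) auto
    ultimately have "sin (pi * x) \<ge> 2 * (1 - x)" by metis
    moreover have "2 * t \<le> 2 * (1 - x)" using assms by simp
    ultimately show ?thesis by (rule order_trans[rotated])
  qed
qed

text \<open>The real part does not depend on \<open>x\<close>, and the imaginary part is monotone: along a monotone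
  sequence of phases the total variation of this quotient telescopes.\<close>

lemma inverse_one_minus_cis:
  assumes "sin x \<noteq> 0"
  shows "1 / (1 - cis (2 * x)) = Complex (1/2) (cot x / 2)"
proof -
  have eq: "1 - cis (2 * x) = Complex (2 * sin x * sin x) (- 2 * sin x * cos x)"
    by (simp add: complex_eq_iff cos_double sin_double power2_eq_square)
       (metis (no_types, opaque_lifting) power2_eq_square sin_squared_eq)
  have "Complex (1/2) (cot x / 2) * Complex (2 * sin x * sin x) (- 2 * sin x * cos x) = 1"
  proof -
    have "sin x * sin x + cos x * cos x = 1" by (metis sin_cos_squared_add3 add.commute)
    then show ?thesis using assms
      by (simp add: complex_eq_iff cot_def field_simps)
  qed
  moreover have "1 - cis (2 * x) \<noteq> 0" unfolding eq using assms by (simp add: complex_eq_iff)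
  ultimately show ?thesis unfolding eq by (simp add: field_simps)
qed

lemma cot_antimono:
  fixes x y :: real
  assumes "0 < x" "x \<le> y" "y < pi"
  shows "cot y \<le> cot x"
proof -
  have "sin x > 0" "sin y > 0" using assms by (auto intro!: sin_gt_zero)
  moreover have "sin (y - x) \<ge> 0" using assms by (intro sin_ge_zero) auto
  ultimately show ?thesis by (simp add: cot_def sin_diff field_simps)
qed

text \<open>The first derivative test: while the increments avoid the integers by t, each term is a
  bounded quotient times the difference of consecutive terms, so Abel summation leaves two boundary
  terms and the variation of the quotients.\<close>

lemma kusmin_landau:
  fixes u D :: "nat \<Rightarrow> real" and k :: int and t :: real
  defines "D \<equiv> \<lambda>n. u (Suc n) - u n"
  assumes t: "0 < t"
    and mono: "\<And>m n. a \<le> m \<Longrightarrow> m \<le> n \<Longrightarrow> n < b \<Longrightarrow> D m \<le> D n"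
    and rng: "\<And>n. a \<le> n \<Longrightarrow> n < b \<Longrightarrow> k + t \<le> D n \<and> D n \<le> k + 1 - t"
  shows "norm (\<Sum>n\<in>{a..<b}. cis (2 * pi * u n)) \<le> 1 / t"
proof (cases "a < b")
  case False
  then show ?thesis using t by simp
next
  case ab: True
  \<comment> \<open>Half the phase increment, reduced by k whole turns so that it lies strictly
    between 0 and pi, where \<open>cot\<close> is decreasing.\<close>
  define x where "x n = pi * (D n - k)" for n
  define c where "c n = 1 / (1 - cis (2 * x n))" for n
  define E where "E n = cis (2 * pi * u n)" for n
  have sinx: "sin (x n) \<ge> 2 * t" if "a \<le> n" "n < b" for n
    unfolding x_def using rng[OF that] t by (intro sin_ge_two_mul) auto
  have xr: "0 < x n" "x n < pi" if "a \<le> n" "n < b" for n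
    unfolding x_def using rng[OF that] t by auto
  have cval: "c n = Complex (1/2) (cot (x n) / 2)" if "a \<le> n" "n < b" for n
    unfolding c_def using sinx[OF that] t by (intro inverse_one_minus_cis) auto
  have cisx: "cis (2 * x n) * E n = E (Suc n)" for n
  proof -
    have "cis (2 * x n) * E n = cis (2 * pi * u (Suc n) - 2 * pi * k)"
      unfolding E_def cis_mult x_def D_def by (simp add: algebra_simps)
    also have "\<dots> = E (Suc n)"
      unfolding E_def cis_divide[symmetric] using cis_multiple_2pi[of "of_int k"]
      by (simp add: mult.assoc mult.commute mult.left_commute)
    finally show ?thesis .
  qed
  have cnz: "1 - cis (2 * x n) \<noteq> 0" if "a \<le> n" "n < b" for n
  proof
    assume "1 - cis (2 * x n) = 0"
    then have "c n = 0" unfolding c_def by simp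
    with cval[OF that] show False by (simp add: complex_eq_iff)
  qed
  have cabs: "norm (c n) \<le> 1 / (4 * t)" if "a \<le> n" "n < b" for n
  proof -
    have s: "sin (x n) > 0" using sinx[OF that] t by linarith
    have "(norm (c n))\<^sup>2 = (1 / (2 * sin (x n)))\<^sup>2"
    proof -
      have "(norm (c n))\<^sup>2 = (1/2)\<^sup>2 + (cot (x n) / 2)\<^sup>2" using cval[OF that] by (simp add: cmod_power2)
      also have "\<dots> = ((sin (x n))\<^sup>2 + (cos (x n))\<^sup>2) / (2 * sin (x n))\<^sup>2"
        using s by (simp add: cot_def field_simps power2_eq_square)
      finally show ?thesis by (simp add: power_divide)
    qed
    then have "norm (c n) = 1 / (2 * sin (x n))"
      by (rule power2_eq_imp_eq) (use s in auto)
    also have "\<dots> \<le> 1 / (4 * t)" using sinx[OF that] s t by (simp add: field_simps)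
    finally show ?thesis .
  qed
  have Ec: "E n = c n * (E n - E (Suc n))" if "a \<le> n" "n < b" for n
    using cnz[OF that] unfolding cisx[symmetric] c_def by (simp add: field_simps)
  have dif: "norm (c n - c (n - 1)) = Im (c (n - 1)) - Im (c n)" if "Suc a \<le> n" "n < b" for n
  proof -
    have "a \<le> n - 1" "n - 1 < b" "a \<le> n" using that by auto
    moreover have "x (n - 1) \<le> x n" unfolding x_def using mono[of "n-1" n] that by auto
    ultimately have "cot (x n) \<le> cot (x (n - 1))" using xr that by (intro cot_antimono) auto
    then have "c n - c (n-1) = Complex 0 ((cot (x n) - cot (x (n - 1))) / 2)"
       "Im (c (n - 1)) - Im (c n) = (cot (x (n-1)) - cot (x n)) / 2" "cot (x n) \<le> cot (x (n - 1))"
      using cval[OF \<open>a \<le> n\<close> that(2)] cval[OF \<open>a \<le> n - 1\<close> \<open>n - 1 < b\<close>]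
      by (simp_all only:) (auto simp: complex_eq_iff field_simps)
    then show ?thesis by (simp add: norm_complex_def)
  qed
  have tel: "(\<Sum>n\<in>{Suc a..<b}. norm (c n - c (n - 1))) = Im (c a) - Im (c (b - 1))"
  proof -
    have "(\<Sum>n\<in>{Suc a..<b}. norm (c n - c (n - 1))) = (\<Sum>n\<in>{Suc a..<Suc (b - 1)}. Im (c (n - 1)) - Im (c n))"
      using ab dif by (intro sum.cong) simp_all
    also have "\<dots> = (\<Sum>n\<in>{a..<b-1}. Im (c n) - Im (c (Suc n)))"
      by (subst sum.atLeast_Suc_lessThan_Suc_shift) simp
    also have "\<dots> = Im (c a) - Im (c (b - 1))"
      using sum_Suc_diff'[of a "b - 1" "\<lambda>n. - Im (c n)"] ab by simp
    finally show ?thesis .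
  qed
  have "norm (\<Sum>n\<in>{a..<b}. E n) \<le> norm (c a * E a) + norm (c (b - 1) * E b) +
     norm (\<Sum>n\<in>{Suc a..<b}. (c n - c (n - 1)) * E n)"
    by (subst abel_summation_quotients[where E = E and c = c, OF ab Ec])
       (auto intro: order.trans[OF norm_triangle_ineq] add_mono norm_triangle_ineq4)
  moreover have "norm (\<Sum>n\<in>{Suc a..<b}. (c n - c (n - 1)) * E n) \<le> Im (c a) - Im (c (b - 1))"
    unfolding tel[symmetric] by (rule sum_norm_le) (simp add: E_def norm_mult)
  moreover have "norm (c a) \<le> 1 / (4 * t)" "norm (c (b - 1)) \<le> 1 / (4 * t)"
    using ab by (auto intro!: cabs)
  moreover have "norm (c a * E a) = norm (c a)" "norm (c (b - 1) * E b) = norm (c (b - 1))"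
    by (simp_all add: norm_mult E_def)
  \<comment> \<open>Four contributions of at most 1 / (4 t): the two boundary terms, and the two
    ends of the telescoped variation.\<close>
  moreover have "1 / t = 4 * (1 / (4 * t))" by simp
  ultimately have "norm (\<Sum>n\<in>{a..<b}. E n) \<le> 1 / t"
    using abs_Im_le_cmod[of "c a"] abs_Im_le_cmod[of "c (b - 1)"] by linarith
  then show ?thesis unfolding E_def .
qed

section \<open>Van der Corput's second derivative test\<close>

lemma increments_grow:
  fixes D :: "nat \<Rightarrow> real"
  assumes "\<And>n. a \<le> n \<Longrightarrow> Suc n < b \<Longrightarrow> D n + \<mu> \<le> D (Suc n)"
    and "a \<le> m" "m \<le> n" "n < b"
  shows "D m + \<mu> * real (n - m) \<le> D n"
  using assms(3,4)
proof (induction n rule: dec_induct)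
  case (step n)
  then show ?case using assms(1)[of n] assms(2) by (auto simp: Suc_diff_le algebra_simps)
qed simp

text \<open>Serves for the indices whose increments come too near an integer for
  \<open>kusmin_landau\<close>. Growth by \<mu> per step between the smallest and the largest member
  of \<open>Q\<close> leaves room for only a few.\<close>

lemma card_growing_in_interval:
  fixes D :: "nat \<Rightarrow> real"
  assumes inc: "\<And>n. a \<le> n \<Longrightarrow> Suc n < b \<Longrightarrow> D n + \<mu> \<le> D (Suc n)"
    and "0 < \<mu>" "0 \<le> w" "Q \<subseteq> {a..<b}" and rng: "\<And>n. n \<in> Q \<Longrightarrow> x \<le> D n \<and> D n \<le> x + w"
  shows "real (card Q) \<le> w / \<mu> + 1"
proof (cases "Q = {}")
  case True
  then show ?thesis using assms by simp
next
  case False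
  have fin: "finite Q" using assms(4) finite_subset by blast
  define m where "m = Min Q"
  define n where "n = Max Q"
  have mem: "m \<in> Q" "n \<in> Q" "Q \<subseteq> {m..n}" unfolding m_def n_def using False fin by auto
  then have "m \<le> n" by auto
  have "D m + \<mu> * real (n - m) \<le> D n"
  proof (rule increments_grow[of a b])
    show "D n + \<mu> \<le> D (Suc n)" if "a \<le> n" "Suc n < b" for n using inc that .
    show "a \<le> m" "n < b" using mem assms(4) by auto
  qed (rule \<open>m \<le> n\<close>)
  with rng[OF mem(1)] rng[OF mem(2)] have "real (n - m) \<le> w / \<mu>"
    using assms(2) by (simp add: field_simps)
  moreover have "card Q \<le> n - m + 1" using card_mono[OF _ mem(3)] \<open>m \<le> n\<close> by simp
  ultimately show ?thesis by linarith
qed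

text \<open>Indices are grouped by the integer part of their increment, which gives at most V + 2
  groups. Within a group, those within t of either integer are few and are counted; the others form
  one run to which \<open>kusmin_landau\<close> applies.\<close>

lemma van_der_corput:
  fixes u D :: "nat \<Rightarrow> real" and \<mu> V x :: real
  defines "D \<equiv> \<lambda>n. u (Suc n) - u n"
  assumes inc: "\<And>n. a \<le> n \<Longrightarrow> Suc n < b \<Longrightarrow> D n + \<mu> \<le> D (Suc n)"
    and rng: "\<And>n. a \<le> n \<Longrightarrow> n < b \<Longrightarrow> x \<le> D n \<and> D n \<le> x + V"
    and \<mu>: "0 < \<mu>" "\<mu> \<le> 1" and V: "0 \<le> V"
  shows "norm (\<Sum>n\<in>{a..<b}. cis (2 * pi * u n)) \<le> 5 * (V + 2) / sqrt \<mu>"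
proof -
  define E where "E n = cis (2 * pi * u n)" for n
  \<comment> \<open>Balances the count t / \<mu> near the integers against the bound 1 / t in
    between.\<close>
  define t where "t = sqrt \<mu> / 2"
  have t: "0 < t" and tmu: "t / \<mu> = 1 / (2 * sqrt \<mu>)"
    using \<mu> by (auto simp: t_def field_simps)
  have mono: "D m \<le> D n" if "a \<le> m" "m \<le> n" "n < b" for m n
    using increments_grow[of a b D \<mu> m n] inc that \<mu> by (smt (verit) mult_nonneg_nonneg of_nat_0_le_iff)
  have cnt: "norm (\<Sum>n\<in>Q. E n) \<le> t / \<mu> + 1"
    if "Q \<subseteq> {a..<b}" "\<And>n. n \<in> Q \<Longrightarrow> y \<le> D n \<and> D n \<le> y + t" for Q y
  proof -
    have "norm (\<Sum>n\<in>Q. E n) \<le> (\<Sum>n\<in>Q. 1)" by (rule sum_norm_le) (simp add: E_def)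
    also have "\<dots> \<le> t / \<mu> + 1"
      using card_growing_in_interval[of a b D \<mu> t Q y] inc \<mu> t that by simp
    finally show ?thesis .
  qed
  define P where "P k = {n \<in> {a..<b}. \<lfloor>D n\<rfloor> = k}" for k
  have block: "norm (\<Sum>n\<in>P k. E n) \<le> 5 / sqrt \<mu>" for k
  proof -
    define P1 where "P1 = {n \<in> {a..<b}. \<lfloor>D n\<rfloor> = k \<and> D n < k + t}"
    define P2 where "P2 = {n \<in> {a..<b}. \<lfloor>D n\<rfloor> = k \<and> \<not> D n < k + t \<and> k + 1 - t < D n}"
    define M where "M = {n \<in> {a..<b}. \<lfloor>D n\<rfloor> = k \<and> \<not> D n < k + t \<and> \<not> k + 1 - t < D n}"
    have split: "(\<Sum>n\<in>P k. E n) = (\<Sum>n\<in>P1. E n) + (\<Sum>n\<in>P2. E n) + (\<Sum>n\<in>M. E n)"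
    proof -
      have "P k = (P1 \<union> P2) \<union> M" "(P1 \<union> P2) \<inter> M = {}" "P1 \<inter> P2 = {}" "finite P1" "finite P2" "finite M"
        unfolding P_def P1_def P2_def M_def by auto
      then show ?thesis by (simp add: sum.union_disjoint)
    qed
    have "norm (\<Sum>n\<in>P1. E n) \<le> t / \<mu> + 1"
      by (rule cnt[of _ "real_of_int k"]) (auto simp: P1_def floor_eq_iff)
    moreover have "norm (\<Sum>n\<in>P2. E n) \<le> t / \<mu> + 1"
      by (rule cnt[of _ "k + 1 - t"]) (auto simp: P2_def floor_eq_iff)
    moreover have "norm (\<Sum>n\<in>M. E n) \<le> 1 / t"
    proof (cases "M = {}")
      case True
      then show ?thesis using t by simp
    next
      case False
      have fin: "finite M" unfolding M_def by auto
      define c where "c = Min M"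
      define d where "d = Max M"
      have mem: "c \<in> M" "d \<in> M" "M \<subseteq> {c..d}" unfolding c_def d_def using False fin by auto
      have r: "k + t \<le> D n \<and> D n \<le> k + 1 - t" if "c \<le> n" "n < Suc d" for n
      proof -
        have "D c \<le> D n" "D n \<le> D d" using mem that by (auto intro!: mono simp: M_def)
        then show ?thesis using mem by (auto simp: M_def)
      qed
      \<comment> \<open>Monotone increments make M a run of consecutive indices.\<close>
      have "M = {c..<Suc d}"
      proof
        show "{c..<Suc d} \<subseteq> M"
        proof
          fix n assume n: "n \<in> {c..<Suc d}"
          then have "D c \<le> D n" "D n \<le> D d" "n \<in> {a..<b}" using mem by (auto intro!: mono simp: M_def)
          then show "n \<in> M" using mem by (auto simp: M_def floor_eq_iff)
        qed
      qed (use mem in auto)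
      moreover have "norm (\<Sum>n\<in>{c..<Suc d}. E n) \<le> 1 / t"
        unfolding E_def
      proof (rule kusmin_landau[where k = k])
        show "u (Suc m) - u m \<le> u (Suc n) - u n" if "c \<le> m" "m \<le> n" "n < Suc d" for m n
          using mono[of m n] that mem unfolding D_def M_def by auto
        show "k + t \<le> u (Suc n) - u n \<and> u (Suc n) - u n \<le> k + 1 - t" if "c \<le> n" "n < Suc d" for n
          using r[OF that] unfolding D_def .
      qed (rule t)
      ultimately show ?thesis by simp
    qed
    ultimately have "norm (\<Sum>n\<in>P k. E n) \<le> (t / \<mu> + 1) + (t / \<mu> + 1) + 1 / t"
      unfolding split by (intro order.trans[OF norm_triangle_ineq] add_mono) auto
    also have "\<dots> = 3 / sqrt \<mu> + 2" unfolding tmu by (simp add: t_def field_simps)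
    also have "2 \<le> 2 / sqrt \<mu>" using \<mu> by (simp add: field_simps)
    finally show ?thesis by (simp add: field_simps)
  qed
  define K where "K = {\<lfloor>x\<rfloor>..\<lfloor>x + V\<rfloor>}"
  have "(\<Sum>n\<in>{a..<b}. E n) = (\<Sum>k\<in>K. \<Sum>n\<in>P k. E n)"
    unfolding P_def
  proof (rule sum.group[symmetric])
    show "(\<lambda>n. \<lfloor>D n\<rfloor>) ` {a..<b} \<subseteq> K"
      using rng by (auto simp: K_def intro!: floor_mono)
  qed (auto simp: K_def)
  also have "norm \<dots> \<le> (\<Sum>k\<in>K. 5 / sqrt \<mu>)" by (rule sum_norm_le) (rule block)
  also have "\<dots> = real (card K) * (5 / sqrt \<mu>)" by simp
  also have "\<dots> \<le> (V + 2) * (5 / sqrt \<mu>)"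
  proof (rule mult_right_mono)
    show "real (card K) \<le> V + 2" unfolding K_def using V by (simp, linarith)
  qed (use \<mu> in simp)
  finally show ?thesis unfolding E_def by (simp add: field_simps)
qed

text \<open>Multiplying the phases by h scales the growth l and the range V by h. The last summand
  on the right serves only the case h l > 1, which keeps the bound valid for every
  frequency.\<close>

lemma van_der_corput_harmonic:
  fixes w :: "nat \<Rightarrow> real" and l V x :: real and h :: nat
  assumes inc: "\<And>n. a \<le> n \<Longrightarrow> n + 2 < b \<Longrightarrow> w (n + 1) - w n + l \<le> w (n + 2) - w (n + 1)"
    and rng: "\<And>n. a \<le> n \<Longrightarrow> n + 1 < b \<Longrightarrow> x \<le> w (n + 1) - w n \<and> w (n + 1) - w n \<le> x + V"
    and l: "0 < l" and V: "0 \<le> V" and h: "0 < h" and ab: "a < b"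
  shows "norm (\<Sum>n\<in>{a..<b}. cis (2 * pi * (real h * w n))) \<le>
    5 * V * sqrt h / sqrt l + 11 / sqrt (h * l) + 2 * sqrt (h * l)"
proof (cases "h * l \<le> 1")
  case True
  define E where "E n = cis (2 * pi * (real h * w n))" for n
  have hl: "0 < h * l" using h l by simp
  have "norm (\<Sum>n\<in>{a..<b-1}. E n) \<le> 5 * (h * V + 2) / sqrt (h * l)"
    unfolding E_def
  proof (rule van_der_corput[where x = "h * x"])
    fix n assume n: "a \<le> n"
    show "h * w (Suc n) - h * w n + h * l \<le> h * w (Suc (Suc n)) - h * w (Suc n)" if "Suc n < b - 1"
      using mult_left_mono[OF inc[of n], of h] n that by (simp add: algebra_simps)
    show "h * x \<le> h * w (Suc n) - h * w n \<and> h * w (Suc n) - h * w n \<le> h * x + h * V" if "n < b - 1"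
      using mult_left_mono[of x "w (n+1) - w n" h] mult_left_mono[of "w (n+1) - w n" "x + V" h] rng[of n] n that
      by (auto simp add: algebra_simps)
  qed (use hl True V in auto)
  \<comment> \<open>The b - a values have only b - a - 1 increments, so the last term is split
    off.\<close>
  moreover have "(\<Sum>n\<in>{a..<b}. E n) = (\<Sum>n\<in>{a..<b-1}. E n) + E (b-1)"
    using ab sum.atLeastLessThan_Suc[of a "b-1" E] by simp
  moreover have "norm (E (b-1)) = 1" by (simp add: E_def)
  ultimately have "norm (\<Sum>n\<in>{a..<b}. E n) \<le> 5 * (h * V + 2) / sqrt (h * l) + 1"
    using norm_triangle_ineq[of "\<Sum>n\<in>{a..<b-1}. E n" "E (b-1)"] by simp
  moreover have "1 \<le> 1 / sqrt (h * l)" using hl True by (simp add: field_simps)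
  moreover have "5 * (h * V + 2) / sqrt (h * l) = 5 * V * sqrt h / sqrt l + 10 / sqrt (h * l)"
    using h l by (simp add: real_sqrt_mult field_simps)
  moreover have "0 \<le> 2 * sqrt (h * l)" using hl by simp
  moreover have "11 / sqrt (h * l) = 10 / sqrt (h * l) + 1 / sqrt (h * l)"
    by (simp flip: add_divide_distrib)
  ultimately show ?thesis unfolding E_def by linarith
next
  case False
  \<comment> \<open>\<open>van_der_corput\<close> requires growth at most 1. Here the range V admits
    at most V / l + 2 terms, and the trivial bound suffices.\<close>
  have hl: "1 \<le> sqrt (h * l)" using False by simp
  have "norm (\<Sum>n\<in>{a..<b}. cis (2 * pi * (real h * w n))) \<le> (\<Sum>n\<in>{a..<b}. 1)"
    by (rule sum_norm_le) simp
  also have "\<dots> = real (card {a..<b-1}) + 1" using ab by simp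
  also have "real (card {a..<b-1}) \<le> V / l + 1"
    by (rule card_growing_in_interval[where a = a and b = "b-1" and D = "\<lambda>n. w (n + 1) - w n" and x = x])
       (use inc rng l V in auto)
  also have "V / l \<le> V / l * sqrt (h * l)" using mult_left_mono[OF hl, of "V / l"] V l by simp
  also have "\<dots> = V * sqrt h / sqrt l" using l by (simp add: real_sqrt_mult field_simps)
  finally have "norm (\<Sum>n\<in>{a..<b}. cis (2 * pi * (real h * w n))) \<le> V * sqrt h / sqrt l + 2" by simp
  moreover have "V * sqrt h / sqrt l \<ge> 0" "11 / sqrt (h * l) \<ge> 0" using V l by auto
  ultimately show ?thesis using hl by linarith
qed

section \<open>The Fourier series of the second Bernoulli polynomial\<close>

text \<open>The polar form is 2 sin(t/2) cis(t/2 - pi/2), with argument strictly between -pi/2 and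
  pi/2, so the principal branch applies. The value is the limit, as the damping disappears, of the
  derivative of \<open>cos_series\<close>.\<close>

lemma Im_Ln_one_minus_cis:
  assumes "0 < t" "t < 2 * pi"
  shows "Im (Ln (1 - cis t)) = (t - pi) / 2" and "1 - cis t \<notin> \<real>\<^sub>\<le>\<^sub>0"
proof -
  define x where "x = t / 2"
  have s: "sin x > 0" using assms unfolding x_def by (intro sin_gt_zero) auto
  have eq: "1 - cis t = of_real (2 * sin x) * cis (x - pi / 2)"
  proof -
    have "cos t = 1 - 2 * (sin x)\<^sup>2" "sin t = 2 * sin x * cos x"
      using cos_double_sin[of x] sin_double[of x] by (simp_all add: x_def)
    then show ?thesis by (simp add: complex_eq_iff cos_diff sin_diff power2_eq_square)
  qed
  have "Ln (1 - cis t) = ln (2 * sin x) + \<i> * of_real (x - pi / 2)"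
  proof -
    have "Ln (cis (x - pi / 2)) = \<i> * of_real (x - pi / 2)"
      unfolding cis_conv_exp using assms by (intro Ln_exp) (auto simp: x_def)
    then show ?thesis unfolding eq using s by (subst Ln_times_of_real) (simp_all add: Ln_of_real cis_neq_zero del: of_real_mult)
  qed
  moreover have "Im (of_real y + \<i> * of_real z) = z" for y z by simp
  ultimately have "Im (Ln (1 - cis t)) = x - pi / 2" by metis
  then show "Im (Ln (1 - cis t)) = (t - pi) / 2" by (simp add: x_def field_simps)
  have "cos t < 1"
  proof -
    have "cos t = 1 - 2 * (sin x)\<^sup>2" using cos_double_sin[of x] by (simp add: x_def)
    then show ?thesis using s by simp
  qed
  then show "1 - cis t \<notin> \<real>\<^sub>\<le>\<^sub>0" by (auto simp: complex_nonpos_Reals_iff)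
qed

text \<open>The term for \<open>n = 0\<close> vanishes, because \<open>x / 0 = 0\<close>. The damping factor \<open>r < 1\<close> makes
  termwise differentiation legitimate; the closed form is needed at \<open>r = 1\<close> only.\<close>

definition cos_series :: "real \<Rightarrow> real \<Rightarrow> real" where
  "cos_series r x = (\<Sum>n. r ^ n * cos (real n * x) / (real n)\<^sup>2)"

lemma summable_inverse_squares: "summable (\<lambda>n. 1 / (real n)\<^sup>2)"
  using inverse_power_summable[of 2, where 'a=real] by (simp add: inverse_eq_divide)

lemma cos_series_term_bound:
  assumes "0 \<le> r" "r \<le> 1"
  shows "\<bar>r ^ n * cos (real n * x)\<bar> / (real n)\<^sup>2 \<le> 1 / (real n)\<^sup>2"
proof -
  have "r ^ n * \<bar>cos (real n * x)\<bar> \<le> 1 * 1"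
    using assms by (intro mult_mono power_le_one) auto
  then show ?thesis using assms by (auto simp: abs_mult divide_right_mono)
qed

lemma cos_series_summable:
  assumes "0 \<le> r" "r \<le> 1"
  shows "summable (\<lambda>n. r ^ n * cos (real n * x) / (real n)\<^sup>2)"
  by (rule summable_comparison_test'[OF summable_inverse_squares])
     (use cos_series_term_bound[OF assms] in simp)

text \<open>Termwise differentiation gives minus the sum of r^n sin(n x) / n, the imaginary part of
  the logarithm series; the geometric majorant r^n makes the convergence uniform.\<close>

lemma cos_series_deriv:
  assumes "0 \<le> r" "r < 1"
  shows "(cos_series r has_real_derivative Im (Ln (1 - of_real r * cis x))) (at x)"
proof -
  have fs: "(\<lambda>n. - (r ^ n * sin (real n * y) / real n)) sums Im (Ln (1 - of_real r * cis y))" for y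
  proof -
    have "(\<lambda>n. - ((of_real r * cis y) ^ n) / of_nat n) sums Ln (1 - of_real r * cis y)"
      using Ln_series'[of "- (of_real r * cis y)"] assms by (simp add: norm_mult)
    moreover have "(of_real r * cis y) ^ n = of_real (r ^ n) * cis (real n * y)" for n
      by (simp add: power_mult_distrib Complex.DeMoivre)
    ultimately have "(\<lambda>n. - (of_real (r ^ n) * cis (real n * y)) / of_nat n) sums Ln (1 - of_real r * cis y)"
      by simp
    from sums_Im[OF this] show ?thesis
      by (simp add: Im_divide_of_nat del: of_real_power)
  qed
  have "((\<lambda>x. \<Sum>n. r ^ n * cos (real n * x) / (real n)\<^sup>2) has_field_derivative
    (\<Sum>n. - (r ^ n * sin (real n * x) / real n))) (at x)"
  proof (rule has_field_derivative_series'(2)[where S = UNIV and ?x0.0 = 0])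
    fix n :: nat and y :: real
    show "((\<lambda>x. r ^ n * cos (real n * x) / (real n)\<^sup>2) has_real_derivative - (r ^ n * sin (real n * y) / real n)) (at y within UNIV)"
      by (cases "n = 0") (auto intro!: derivative_eq_intros simp: power2_eq_square)
  next
    show "uniformly_convergent_on UNIV (\<lambda>n x. \<Sum>i<n. - (r ^ i * sin (real i * x) / real i))"
    proof (rule Weierstrass_m_test')
      show "summable (\<lambda>n. r ^ n)" using assms by (intro summable_geometric) auto
      fix n :: nat and y :: real
      have "r ^ n * \<bar>sin (real n * y)\<bar> / real n \<le> r ^ n * 1"
      proof (cases "n = 0")
        case False
        have "r ^ n * \<bar>sin (real n * y)\<bar> / real n \<le> r ^ n * 1 / 1"
          using False assms by (intro frac_le mult_left_mono) auto
        then show ?thesis by simp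
      qed (use assms in auto)
      then show "norm (- (r ^ n * sin (real n * y) / real n)) \<le> r ^ n"
        using assms by (auto simp: abs_mult)
    qed
  next
    show "summable (\<lambda>n. r ^ n * cos (real n * 0) / (real n)\<^sup>2)" using cos_series_summable[of r 0] assms by simp
  qed auto
  moreover have "(\<Sum>n. - (r ^ n * sin (real n * x) / real n)) = Im (Ln (1 - of_real r * cis x))"
    using fs[of x] by (simp add: sums_iff)
  ultimately show ?thesis unfolding cos_series_def[abs_def] by simp
qed

lemma one_minus_cis_not_nonpos:
  assumes "0 \<le> r" "r < 1"
  shows "1 - of_real r * cis x \<notin> \<real>\<^sub>\<le>\<^sub>0"
proof -
  have "r * cos x \<le> r * 1" using assms by (intro mult_left_mono) auto
  then have "Re (1 - of_real r * cis x) > 0" using assms by simp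
  then show ?thesis by (auto simp: complex_nonpos_Reals_iff)
qed

lemma continuous_on_cos_series:
  shows "continuous_on UNIV (cos_series 1)" and "continuous_on {0..1} (\<lambda>r. cos_series r x)"
proof -
  have *: "continuous_on S (\<lambda>y. \<Sum>n. g n y)"
    if "\<And>n y. y \<in> S \<Longrightarrow> norm (g n y) \<le> 1 / (real n)\<^sup>2" "\<And>n. continuous_on S (g n)"
    for S :: "real set" and g :: "nat \<Rightarrow> real \<Rightarrow> real"
  proof (rule uniform_limit_theorem)
    show "uniform_limit S (\<lambda>n y. \<Sum>i<n. g i y) (\<lambda>y. \<Sum>n. g n y) sequentially"
      by (rule Weierstrass_m_test[OF that(1) summable_inverse_squares])
    show "\<forall>\<^sub>F n in sequentially. continuous_on S (\<lambda>y. \<Sum>i<n. g i y)"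
      by (intro always_eventually allI continuous_on_sum that(2))
  qed auto
  show "continuous_on UNIV (cos_series 1)" unfolding cos_series_def[abs_def]
  proof (rule *)
    show "norm (1 ^ n * cos (real n * y) / (real n)\<^sup>2) \<le> 1 / (real n)\<^sup>2" for n y
      using cos_series_term_bound[of 1 n y] by simp
    show "continuous_on UNIV (\<lambda>y. 1 ^ n * cos (real n * y) / (real n)\<^sup>2)" for n
      unfolding divide_inverse by (intro continuous_intros)
  qed
  show "continuous_on {0..1} (\<lambda>r. cos_series r x)" unfolding cos_series_def
  proof (rule *)
    show "norm (y ^ n * cos (real n * x) / (real n)\<^sup>2) \<le> 1 / (real n)\<^sup>2" if "y \<in> {0..1}" for n y
      using cos_series_term_bound[of y n x] that by simp
    show "continuous_on {0..1} (\<lambda>y. y ^ n * cos (real n * x) / (real n)\<^sup>2)" for n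
      unfolding divide_inverse by (intro continuous_intros)
  qed
qed

lemma Im_Ln_tendsto:
  assumes "0 < t" "t < 2 * pi"
  shows "((\<lambda>r. Im (Ln (1 - of_real r * cis t))) \<longlongrightarrow> (t - pi) / 2) (at_left 1)"
proof -
  have "isCont (\<lambda>r. Im (Ln (1 - of_real r * cis t))) (1::real)"
  proof (intro isCont_Im isCont_Ln')
    show "isCont (\<lambda>r. 1 - complex_of_real r * cis t) 1" by (intro continuous_intros)
  qed (use Im_Ln_one_minus_cis(2)[OF assms] in simp)
  then show ?thesis
    unfolding isCont_def using Im_Ln_one_minus_cis(1)[OF assms] 
    by (metis (no_types, lifting) filterlim_at_split mult_1 of_real_1)
qed

text \<open>For r < 1 the difference is an integral of the derivative. As r tends to 1, dominated
  convergence applies, since the imaginary part of \<open>Ln\<close> is bounded by pi. The interval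
  stays inside (0, 2 pi) because 1 - cis t vanishes at both ends.\<close>

lemma cos_series_diff:
  assumes "0 < a" "a \<le> b" "b < 2 * pi"
  shows "cos_series 1 b - cos_series 1 a = (b - pi)\<^sup>2 / 4 - (a - pi)\<^sup>2 / 4"
proof -
  define s where "s k = 1 - 1 / (real k + 1)" for k :: nat
  have s: "0 \<le> s k" "s k < 1" for k by (auto simp: s_def field_simps)
  have slim: "s \<longlonglongrightarrow> 1" unfolding s_def[abs_def]
    using tendsto_diff[OF tendsto_const LIMSEQ_inverse_real_of_nat, of 1] by (simp add: inverse_eq_divide add.commute)
  have sl: "filterlim s (at_left 1) sequentially"
    unfolding filterlim_at using slim s by (auto intro!: always_eventually simp: less_imp_neq)
  define g where "g k t = Im (Ln (1 - of_real (s k) * cis t))" for k t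
  have gi: "(g k has_integral (cos_series (s k) b - cos_series (s k) a)) {a..b}" for k
    unfolding g_def using cos_series_deriv[OF s] assms
    by (intro fundamental_theorem_of_calculus)
       (auto simp: has_real_derivative_iff_has_vector_derivative[symmetric] intro: DERIV_subset)
  have lim: "(\<lambda>k. integral {a..b} (g k)) \<longlonglongrightarrow> integral {a..b} (\<lambda>t. (t - pi) / 2)"
  proof (rule dominated_convergence(2))
    show "g k integrable_on {a..b}" for k using gi by blast
    show "(\<lambda>t. pi) integrable_on {a..b}" by (rule integrable_const_ivl)
    show "norm (g k t) \<le> pi" for k t
      using one_minus_cis_not_nonpos[OF s, of k t] unfolding g_def real_norm_def
      by (smt (verit) Im_Ln_le_pi mpi_less_Im_Ln complex_nonpos_Reals_iff zero_complex.sel)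
    show "(\<lambda>k. g k t) \<longlonglongrightarrow> (t - pi) / 2" if "t \<in> {a..b}" for t
      using that assms unfolding g_def by (intro filterlim_compose[OF Im_Ln_tendsto sl]) auto
  qed
  have gint: "integral {a..b} (g k) = cos_series (s k) b - cos_series (s k) a" for k
    using gi by (rule integral_unique)
  have "((\<lambda>t. (t - pi) / 2) has_integral ((b - pi)\<^sup>2 / 4 - (a - pi)\<^sup>2 / 4)) {a..b}"
    using assms
    by (intro fundamental_theorem_of_calculus)
       (auto simp: has_real_derivative_iff_has_vector_derivative[symmetric] intro!: derivative_eq_intros)
  then have lint: "integral {a..b} (\<lambda>t. (t - pi) / 2) = (b - pi)\<^sup>2 / 4 - (a - pi)\<^sup>2 / 4"
    by (rule integral_unique)
  have "(\<lambda>k. cos_series (s k) b - cos_series (s k) a) \<longlonglongrightarrow> (b - pi)\<^sup>2 / 4 - (a - pi)\<^sup>2 / 4"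
    using lim unfolding gint lint .
  moreover have "(\<lambda>k. cos_series (s k) x) \<longlonglongrightarrow> cos_series 1 x" for x
    by (rule continuous_on_tendsto_compose[OF continuous_on_cos_series(2) slim])
       (use s in \<open>auto intro!: always_eventually less_imp_le\<close>)
  then have "(\<lambda>k. cos_series (s k) b - cos_series (s k) a) \<longlonglongrightarrow> cos_series 1 b - cos_series 1 a"
    by (intro tendsto_diff)
  ultimately show ?thesis using LIMSEQ_unique by blast
qed

text \<open>By \<open>cos_series_diff\<close>, subtracting the parabola leaves a constant on the
  open interval, and continuity carries it to x = 0. The value at 0 stays unevaluated, since only
  differences are taken later.\<close>

lemma cos_series_closed_form:
  assumes "0 \<le> x" "x < 1"
  shows "cos_series 1 (2 * pi * x) = cos_series 1 0 + pi\<^sup>2 * (x\<^sup>2 - x)"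
proof -
  define h where "h y = cos_series 1 (2 * pi * y) - pi\<^sup>2 * (y\<^sup>2 - y)" for y
  have "continuous_on UNIV h" unfolding h_def
    by (intro continuous_intros continuous_on_compose2[OF continuous_on_cos_series(1)]) auto
  have c: "h y = h (1/2)" if "0 < y" "y < 1" for y
  proof -
    have "cos_series 1 (2 * pi * y) - cos_series 1 pi = (2 * pi * y - pi)\<^sup>2 / 4 - (pi - pi)\<^sup>2 / 4"
    proof (cases "y \<le> 1/2")
      case True
      then show ?thesis using cos_series_diff[of "2 * pi * y" pi] that by simp
    next
      case False
      then show ?thesis using cos_series_diff[of pi "2 * pi * y"] that by simp
    qed
    then show ?thesis by (simp add: h_def power2_eq_square field_simps)
  qed
  have "(\<lambda>n. h (1 / (real n + 2))) \<longlonglongrightarrow> h 0"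
    by (rule continuous_on_tendsto_compose[OF \<open>continuous_on UNIV h\<close>]) (use LIMSEQ_ignore_initial_segment[OF LIMSEQ_inverse_real_of_nat, of 1] in \<open>auto simp: inverse_eq_divide add_ac\<close>)
  moreover have "h (1 / (real n + 2)) = h (1/2)" for n by (intro c) (auto simp: field_simps)
  ultimately have "h 0 = h (1/2)" by (simp add: LIMSEQ_const_iff)
  then have "h x = h 0" using c[of x] assms by (cases "x = 0") auto
  then show ?thesis by (simp add: h_def)
qed

section \<open>Sums of the sawtooth function\<close>

text \<open>The value -1/2 at integers, instead of the midpoint 0 of the Fourier series, makes the
  floor of x exactly x - \<open>saw x\<close> - 1/2.\<close>

definition saw :: "real \<Rightarrow> real" where "saw x = frac x - 1 / 2"

lemma abs_saw_le: "\<bar>saw x\<bar> \<le> 1 / 2"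
  using frac_ge_0[of x] frac_lt_1[of x] unfolding saw_def by linarith

text \<open>Half the periodic second Bernoulli polynomial without its constant 1/12; away from
  integers its derivative is \<open>saw\<close>.\<close>

definition bern2 :: "real \<Rightarrow> real" where "bern2 x = ((frac x)\<^sup>2 - frac x) / 2"

text \<open>A parabola lies above its periodic continuation: with m the floor and f the fractional
  part of v, twice the difference is m (2 f + m - 1), whose factors never have opposite signs for
  integer m.\<close>

lemma bern2_le: "bern2 v \<le> (v\<^sup>2 - v) / 2"
proof -
  define m where "m = \<lfloor>v\<rfloor>"
  define f where "f = frac v"
  have v: "v = m + f" by (simp add: m_def f_def frac_def)
  have f: "0 \<le> f" "f < 1" by (simp_all add: f_def frac_lt_1)
  have "0 \<le> real_of_int m * (2 * f + m - 1)"
  proof (cases "m \<ge> 1")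
    case True
    then have "real_of_int m \<ge> 1" by linarith
    then show ?thesis using f by (intro mult_nonneg_nonneg) auto
  next
    case False
    show ?thesis
    proof (cases "m = 0")
      case False
      with \<open>\<not> m \<ge> 1\<close> have "real_of_int m \<le> -1" by linarith
      then show ?thesis using f by (intro mult_nonpos_nonpos) auto
    qed simp
  qed
  moreover have "v\<^sup>2 - v = f\<^sup>2 - f + real_of_int m * (2 * f + m - 1)"
    by (simp add: v power2_eq_square algebra_simps)
  moreover have "bern2 v = (f\<^sup>2 - f) / 2" by (simp add: bern2_def f_def)
  ultimately show ?thesis by simp
qed

text \<open>Both signs of \<open>t\<close> are allowed, so \<open>t = 1/H\<close> and \<open>t = - 1/H\<close> bound the sawtooth from below and
  from above by difference quotients whose Fourier series converge absolutely.\<close>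

lemma bern2_add_le: "bern2 (x + t) \<le> bern2 x + t * saw x + t\<^sup>2 / 2"
proof -
  have "bern2 (x + t) = bern2 (frac x + t)"
  proof -
    have "frac (frac x + t + of_int \<lfloor>x\<rfloor>) = frac (frac x + t)" by (rule frac_add_int_right) simp
    moreover have "frac x + t + of_int \<lfloor>x\<rfloor> = x + t" by (simp add: frac_def)
    ultimately show ?thesis by (simp add: bern2_def)
  qed
  also have "\<dots> \<le> ((frac x + t)\<^sup>2 - (frac x + t)) / 2" by (rule bern2_le)
  also have "\<dots> = bern2 x + t * saw x + t\<^sup>2 / 2"
    by (simp add: bern2_def saw_def power2_eq_square field_simps)
  finally show ?thesis .
qed

lemma cos_series_eq_bern2: "cos_series 1 (2 * pi * x) = cos_series 1 0 + 2 * pi\<^sup>2 * bern2 x"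
proof -
  have "cos (real n * (2 * pi * x)) = cos (real n * (2 * pi * frac x))" for n
  proof -
    have "real n * (2 * pi * x) = real n * (2 * pi * frac x) + 2 * pi * of_int (int n * \<lfloor>x\<rfloor>)"
      by (simp add: frac_def algebra_simps)
    then show ?thesis 
      by (simp only: cos_add cos_int_2pin sin_int_2pin mult_1_right mult_zero_right diff_zero)
  qed
  then have "cos_series 1 (2 * pi * x) = cos_series 1 (2 * pi * frac x)" by (simp add: cos_series_def)
  also have "\<dots> = cos_series 1 0 + pi\<^sup>2 * ((frac x)\<^sup>2 - frac x)"
    by (rule cos_series_closed_form) (auto simp: frac_lt_1)
  finally show ?thesis by (simp add: bern2_def)
qed

lemma norm_cis_minus_one_le: "norm (cis x - 1) \<le> \<bar>x\<bar>" and norm_cis_minus_one_le_2: "norm (cis x - 1) \<le> 2"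
proof -
  have "(norm (cis x - 1))\<^sup>2 = (cos x - 1)\<^sup>2 + (sin x)\<^sup>2" by (simp add: cmod_power2)
  also have "\<dots> = 2 - 2 * cos x"
    using sin_cos_squared_add[of x] by (simp add: power2_eq_square algebra_simps)
  also have "\<dots> = (2 * sin (x / 2))\<^sup>2"
    using cos_double_sin[of "x/2"] by (simp add: power_mult_distrib)
  finally have "(norm (cis x - 1))\<^sup>2 = (2 * sin (x / 2))\<^sup>2" .
  then have "(norm (cis x - 1))\<^sup>2 = \<bar>2 * sin (x / 2)\<bar>\<^sup>2" by (simp only: power2_abs)
  then have eq: "norm (cis x - 1) = \<bar>2 * sin (x / 2)\<bar>"
    by (rule power2_eq_imp_eq) simp_all
  show "norm (cis x - 1) \<le> \<bar>x\<bar>" unfolding eq using abs_sin_x_le_abs_x[of "x/2"] by simp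
  show "norm (cis x - 1) \<le> 2" unfolding eq using abs_sin_le_one[of "x/2"] by (simp add: abs_mult)
qed

text \<open>Majorant of the Fourier coefficients of \<open>x \<mapsto> H (bern2 (x + 1/H) - bern2 x)\<close>.\<close>

definition weight :: "nat \<Rightarrow> nat \<Rightarrow> real" where "weight H h = min (1 / real h) (real H / (real h)\<^sup>2)"

section \<open>From exponential sums to sawtooth sums\<close>

lemma weight_nonneg: "0 \<le> weight H h" by (simp add: weight_def)

text \<open>The cosine coefficient of \<open>bern2\<close> at frequency h is 1 / (2 pi^2 h^2).
  Shifting by t multiplies the harmonic by cis(2 pi h t), and the chord from 1 to that point has
  length at most 2 pi h / H and at most 2; these two bounds give the two branches of
  \<open>weight\<close>.\<close>

lemma sum_bern2_diff_bound:
  fixes w :: "'a \<Rightarrow> real" and F :: "nat \<Rightarrow> real" and H :: nat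
  assumes H: "0 < H" and t: "\<bar>t :: real\<bar> = 1 / H"
    and F: "\<And>h. 0 < h \<Longrightarrow> norm (\<Sum>n\<in>A. cis (2 * pi * (real h * w n))) \<le> F h"
    and sm: "summable (\<lambda>h. weight H h * F h)"
  shows "H * \<bar>\<Sum>n\<in>A. bern2 (w n + t) - bern2 (w n)\<bar> \<le> (\<Sum>h. weight H h * F h)"
proof -
  define E where "E h = (\<Sum>n\<in>A. cis (2 * pi * (real h * w n)))" for h :: nat
  define c where "c h = Re ((cis (2 * pi * h * t) - 1) * E h) / (real h)\<^sup>2" for h :: nat
  have s1: "(\<lambda>h. cos (real h * (2 * pi * x)) / (real h)\<^sup>2) sums (cos_series 1 0 + 2 * pi\<^sup>2 * bern2 x)" for x
    unfolding cos_series_eq_bern2[symmetric] unfolding cos_series_def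
    using summable_sums[OF cos_series_summable[of 1 "2 * pi * x"]] by simp
  have "(\<lambda>h. \<Sum>n\<in>A. cos (real h * (2 * pi * (w n + t))) / (real h)\<^sup>2 - cos (real h * (2 * pi * w n)) / (real h)\<^sup>2)
      sums (\<Sum>n\<in>A. (cos_series 1 0 + 2 * pi\<^sup>2 * bern2 (w n + t)) - (cos_series 1 0 + 2 * pi\<^sup>2 * bern2 (w n)))"
    by (intro sums_sum sums_diff s1)
  moreover have "(\<Sum>n\<in>A. cos (real h * (2 * pi * (w n + t))) / (real h)\<^sup>2 - cos (real h * (2 * pi * w n)) / (real h)\<^sup>2) = c h" for h
  proof -
    have "(cis (2 * pi * h * t) - 1) * E h = (\<Sum>n\<in>A. cis (real h * (2 * pi * (w n + t))) - cis (real h * (2 * pi * w n)))"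
      unfolding E_def sum_distrib_left by (intro sum.cong) (auto simp: left_diff_distrib cis_mult algebra_simps)
    then show ?thesis unfolding c_def by (simp add: sum_divide_distrib sum_subtractf diff_divide_distrib)
  qed
  moreover have "(\<Sum>n\<in>A. (cos_series 1 0 + 2 * pi\<^sup>2 * bern2 (w n + t)) - (cos_series 1 0 + 2 * pi\<^sup>2 * bern2 (w n)))
      = 2 * pi\<^sup>2 * (\<Sum>n\<in>A. bern2 (w n + t) - bern2 (w n))"
    by (simp add: sum_distrib_left right_diff_distrib)
  ultimately have cs: "c sums (2 * pi\<^sup>2 * (\<Sum>n\<in>A. bern2 (w n + t) - bern2 (w n)))" by simp
  have cb: "\<bar>real H / (2 * pi\<^sup>2) * c h\<bar> \<le> weight H h * F h" for h
  proof (cases "h = 0")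
    case True
    then show ?thesis by (simp add: c_def weight_def)
  next
    case False
    have "\<bar>c h\<bar> \<le> norm ((cis (2 * pi * h * t) - 1) * E h) / (real h)\<^sup>2"
      using divide_right_mono[OF abs_Re_le_cmod[of "(cis (2 * pi * h * t) - 1) * E h"], of "(real h)\<^sup>2"]
      unfolding c_def abs_divide by (simp only: abs_power2 zero_le_power2)
    also have "\<dots> = norm (cis (2 * pi * h * t) - 1) * norm (E h) / (real h)\<^sup>2" by (simp add: norm_mult)
    finally have c1: "\<bar>c h\<bar> \<le> norm (cis (2 * pi * h * t) - 1) * norm (E h) / (real h)\<^sup>2" .
    have "real H / (2 * pi\<^sup>2) * norm (cis (2 * pi * h * t) - 1) / (real h)\<^sup>2 \<le> weight H h"
      unfolding weight_def
    proof (rule min.boundedI)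
      have "norm (cis (2 * pi * h * t) - 1) \<le> 2 * pi * h * (1 / H)"
        using norm_cis_minus_one_le[of "2 * pi * h * t"] t by (simp add: abs_mult)
      then have "real H / (2 * pi\<^sup>2) * norm (cis (2 * pi * h * t) - 1) / (real h)\<^sup>2
          \<le> real H / (2 * pi\<^sup>2) * (2 * pi * h * (1 / H)) / (real h)\<^sup>2"
        by (intro divide_right_mono mult_left_mono) auto
      also have "\<dots> = 1 / (pi * h)" using H False by (simp add: power2_eq_square)
      also have "\<dots> \<le> 1 / h" using pi_gt3 False by (simp add: field_simps)
      finally show "real H / (2 * pi\<^sup>2) * norm (cis (2 * pi * h * t) - 1) / (real h)\<^sup>2 \<le> 1 / h" .
      have "real H / (2 * pi\<^sup>2) * norm (cis (2 * pi * h * t) - 1) / (real h)\<^sup>2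
          \<le> real H / (2 * pi\<^sup>2) * 2 / (real h)\<^sup>2"
        by (intro divide_right_mono mult_left_mono norm_cis_minus_one_le_2) auto
      also have "\<dots> \<le> real H / (real h)\<^sup>2"
      proof (rule divide_right_mono)
        have "1 \<le> pi\<^sup>2" using pi_gt3 by (intro one_le_power) simp
        then show "real H / (2 * pi\<^sup>2) * 2 \<le> real H" using H by (simp add: field_simps)
      qed simp
      finally show "real H / (2 * pi\<^sup>2) * norm (cis (2 * pi * h * t) - 1) / (real h)\<^sup>2 \<le> real H / (real h)\<^sup>2" .
    qed
    then have "real H / (2 * pi\<^sup>2) * norm (cis (2 * pi * h * t) - 1) / (real h)\<^sup>2 * norm (E h) \<le> weight H h * F h"
      using F[of h] False unfolding E_def[symmetric] by (intro mult_mono weight_nonneg) auto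
    moreover have "\<bar>real H / (2 * pi\<^sup>2) * c h\<bar> \<le> real H / (2 * pi\<^sup>2) * (norm (cis (2 * pi * h * t) - 1) * norm (E h) / (real h)\<^sup>2)"
      using c1 unfolding abs_mult by (intro mult_mono) auto
    ultimately show ?thesis by (simp add: mult_ac)
  qed
  have "real H / (2 * pi\<^sup>2) * (2 * pi\<^sup>2 * (\<Sum>n\<in>A. bern2 (w n + t) - bern2 (w n))) =
      (\<Sum>h. real H / (2 * pi\<^sup>2) * c h)"
    by (rule sums_unique) (rule sums_mult[OF cs])
  then have "H * (\<Sum>n\<in>A. bern2 (w n + t) - bern2 (w n)) = (\<Sum>h. real H / (2 * pi\<^sup>2) * c h)"
    by (simp only: times_divide_eq_left mult.assoc[symmetric]) simp
  then have "H * \<bar>\<Sum>n\<in>A. bern2 (w n + t) - bern2 (w n)\<bar> = \<bar>\<Sum>h. real H / (2 * pi\<^sup>2) * c h\<bar>"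
    by (metis abs_mult abs_of_nat)
  moreover have "\<bar>\<Sum>h. real H / (2 * pi\<^sup>2) * c h\<bar> \<le> (\<Sum>h. \<bar>real H / (2 * pi\<^sup>2) * c h\<bar>)"
    by (rule summable_rabs) (rule summable_comparison_test'[OF sm], use cb in simp)
  moreover have "\<dots> \<le> (\<Sum>h. weight H h * F h)"
    by (rule suminf_le[OF cb _ sm]) (rule summable_comparison_test'[OF sm], use cb in simp)
  ultimately show ?thesis by linarith
qed

text \<open>The first summand is H times the quadratic error t^2 / 2 of \<open>bern2_add_le\<close>,
  summed over A. It falls with H while the weighted sum grows, so H is left free for later
  balancing.\<close>

lemma sum_saw_bound:
  fixes w :: "'a \<Rightarrow> real" and F :: "nat \<Rightarrow> real" and H :: nat
  assumes H: "0 < H"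
    and F: "\<And>h. 0 < h \<Longrightarrow> norm (\<Sum>n\<in>A. cis (2 * pi * (real h * w n))) \<le> F h"
    and sm: "summable (\<lambda>h. weight H h * F h)"
  shows "\<bar>\<Sum>n\<in>A. saw (w n)\<bar> \<le> card A / (2 * H) + (\<Sum>h. weight H h * F h)"
proof -
  have *: "H * (\<Sum>n\<in>A. bern2 (w n + t) - bern2 (w n)) \<le> H * t * (\<Sum>n\<in>A. saw (w n)) + card A / (2 * H)"
    if t: "\<bar>t\<bar> = 1 / H" for t :: real
  proof -
    have "t\<^sup>2 = \<bar>t\<bar>\<^sup>2" by simp
    also have "\<dots> = 1 / (real H)\<^sup>2" unfolding t by (simp add: power_divide)
    finally have t2: "t\<^sup>2 = 1 / (real H)\<^sup>2" .
    have "(\<Sum>n\<in>A. bern2 (w n + t) - bern2 (w n)) \<le> (\<Sum>n\<in>A. t * saw (w n) + t\<^sup>2 / 2)"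
    proof (rule sum_mono)
      show "bern2 (w n + t) - bern2 (w n) \<le> t * saw (w n) + t\<^sup>2 / 2" for n
        using bern2_add_le[of "w n" t] by linarith
    qed
    also have "\<dots> = t * (\<Sum>n\<in>A. saw (w n)) + card A * t\<^sup>2 / 2"
      by (simp add: sum.distrib sum_distrib_left)
    finally have "H * (\<Sum>n\<in>A. bern2 (w n + t) - bern2 (w n)) \<le> H * (t * (\<Sum>n\<in>A. saw (w n)) + card A * t\<^sup>2 / 2)"
      by (intro mult_left_mono) auto
    also have "\<dots> = H * t * (\<Sum>n\<in>A. saw (w n)) + card A / (2 * H)"
      using H unfolding t2 by (simp add: field_simps power2_eq_square)
    finally show ?thesis .
  qed
  have b: "- (\<Sum>h. weight H h * F h) \<le> H * (\<Sum>n\<in>A. bern2 (w n + t) - bern2 (w n))"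
    if t: "\<bar>t\<bar> = 1 / H" for t :: real
  proof -
    have "H * (- (\<Sum>n\<in>A. bern2 (w n + t) - bern2 (w n))) \<le> H * \<bar>\<Sum>n\<in>A. bern2 (w n + t) - bern2 (w n)\<bar>"
      by (intro mult_left_mono abs_ge_minus_self) simp
    also have "\<dots> \<le> (\<Sum>h. weight H h * F h)" by (rule sum_bern2_diff_bound[OF H t F sm])
    finally show ?thesis by simp
  qed
  have "\<bar>1 / real H\<bar> = 1 / H" "\<bar>- (1 / real H)\<bar> = 1 / H" by simp_all
  from order.trans[OF b[OF this(1)] *[OF this(1)]] order.trans[OF b[OF this(2)] *[OF this(2)]] H
  show ?thesis by simp
qed

text \<open>Discrete comparison with the integrals of x^(-1/2) up to H and of H x^(-3/2) beyond.
  Both branches give 2 sqrt H at M = H; the subtracted tail 2 H / sqrt M is what lets the induction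
  continue past H.\<close>

lemma weight_sqrt_partial:
  assumes H: "0 < H"
  shows "(\<Sum>h<Suc M. weight H h * sqrt h) \<le> (if M \<le> H then 2 * sqrt M else 4 * sqrt H - 2 * real H / sqrt M)"
proof (induction M)
  case 0
  then show ?case by (simp add: weight_def)
next
  case (Suc M)
  show ?case
  proof (cases "Suc M \<le> H")
    case True
    define a where "a = sqrt (real M)"
    define b where "b = sqrt (real (Suc M))"
    have ab: "0 \<le> a" "a \<le> b" "0 < b" "a\<^sup>2 = M" "b\<^sup>2 = Suc M" unfolding a_def b_def by auto
    have "weight H (Suc M) * b \<le> 1 / Suc M * b"
      unfolding weight_def using ab by (intro mult_right_mono) auto
    also have "\<dots> = 1 / b" unfolding ab(5)[symmetric] using ab(3) by (simp add: power2_eq_square)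
    also have "\<dots> \<le> 2 * (b - a)"
    proof -
      have "(b - a) * (b + a) = 1" using ab(4,5) by (simp add: algebra_simps power2_eq_square)
      moreover have "(b - a) * (b + a) \<le> (b - a) * (2 * b)" using ab by (intro mult_left_mono) auto
      ultimately have "1 \<le> 2 * (b - a) * b" by (simp add: mult_ac)
      then show ?thesis using ab(3) by (simp add: pos_divide_le_eq)
    qed
    finally have "weight H (Suc M) * sqrt (Suc M) \<le> 2 * (sqrt (Suc M) - sqrt M)"
      unfolding a_def b_def .
    then show ?thesis using Suc True by simp
  next
    case False
    then have M: "M > 0" "M \<ge> H" using H by auto
    define a where "a = sqrt (real M)"
    define b where "b = sqrt (real (Suc M))"
    have ab: "0 < a" "a \<le> b" "0 < b" "a\<^sup>2 = M" "b\<^sup>2 = Suc M" unfolding a_def b_def using M by auto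
    have "weight H (Suc M) * b \<le> H / (real (Suc M))\<^sup>2 * b"
      unfolding weight_def using ab by (intro mult_right_mono) auto
    also have "\<dots> = H / b ^ 3" unfolding ab(5)[symmetric] using ab(3) by (simp add: field_simps power2_eq_square power3_eq_cube)
    also have "\<dots> \<le> 2 * real H / a - 2 * real H / b"
    proof -
      have "(b - a) * (b + a) = 1" using ab(4,5) by (simp add: algebra_simps power2_eq_square)
      moreover have "(b - a) * (b + a) \<le> (b - a) * (2 * b)" using ab by (intro mult_left_mono) auto
      ultimately have 1: "1 \<le> 2 * (b - a) * b" by (simp add: mult_ac)
      have "a \<le> 2 * (b - a) * b * a" using mult_right_mono[OF 1, of a] ab by simp
      also have "\<dots> \<le> 2 * (b - a) * b * b" using ab by (intro mult_left_mono) auto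
      finally have "1 / b ^ 3 \<le> 2 * (b - a) / (a * b)" using ab by (simp add: field_simps power3_eq_cube)
      then have "H * (1 / b ^ 3) \<le> H * (2 * (b - a) / (a * b))" by (intro mult_left_mono) auto
      also have "H * (2 * (b - a) / (a * b)) = 2 * real H / a - 2 * real H / b" using ab by (simp add: field_simps)
      finally show ?thesis by simp
    qed
    finally have step: "weight H (Suc M) * sqrt (Suc M) \<le> 2 * real H / a - 2 * real H / b" unfolding b_def .
    have "(\<Sum>h<Suc M. weight H h * sqrt h) \<le> 4 * sqrt H - 2 * real H / a"
    proof (cases "M = H")
      case True
      have "2 * real H / a = 2 * (real H / sqrt (real H))" unfolding a_def True by simp
      also have "\<dots> = 2 * sqrt (real H)" by (simp only: real_div_sqrt of_nat_0_le_iff)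
      finally show ?thesis using Suc True unfolding a_def by simp
    qed (use Suc M in \<open>simp add: a_def\<close>)
    then show ?thesis using step False unfolding b_def by simp
  qed
qed

lemma weight_sqrt_sum:
  assumes H: "0 < H"
  shows "summable (\<lambda>h. weight H h * sqrt h)" and "(\<Sum>h. weight H h * sqrt h) \<le> 4 * sqrt H"
proof -
  have b: "(\<Sum>h<M. weight H h * sqrt h) \<le> 4 * sqrt H" for M
  proof (cases M)
    case (Suc k)
    have "(if k \<le> H then 2 * sqrt k else 4 * sqrt H - 2 * real H / sqrt k) \<le> 4 * sqrt H"
    proof (cases "k \<le> H")
      case True
      then have "sqrt k \<le> sqrt H" "0 \<le> sqrt H" by auto
      then have "2 * sqrt k \<le> 4 * sqrt H" by linarith
      then show ?thesis using True by simp
    qed simp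
    with weight_sqrt_partial[OF H, of k] show ?thesis unfolding Suc by (rule order.trans)
  qed simp
  show s: "summable (\<lambda>h. weight H h * sqrt h)"
    by (rule summableI_nonneg_bounded[where x = "4 * sqrt H"]) (use b weight_nonneg in auto)
  show "(\<Sum>h. weight H h * sqrt h) \<le> 4 * sqrt H"
    using s b by (intro suminf_le_const) auto
qed

text \<open>Each term is at most h^(-3/2) whatever H is, and that is the summand of
  \<open>weight_sqrt_sum\<close> for H = 1.\<close>

lemma weight_inverse_sqrt_sum:
  shows "summable (\<lambda>h. weight H h / sqrt h)" and "(\<Sum>h. weight H h / sqrt h) \<le> 4"
proof -
  have b: "weight H h / sqrt h \<le> weight 1 h * sqrt h" for h
  proof (cases "h = 0")
    case False
    then have "1 / (real h)\<^sup>2 \<le> 1 / real h" by (intro divide_left_mono) (auto simp: power2_eq_square)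
    then have "weight 1 h = 1 / (real h)\<^sup>2" unfolding weight_def by (simp add: min_absorb2)
    then have "weight 1 h * sqrt h = 1 / (real h)\<^sup>2 * sqrt h" by simp
    also have "\<dots> = 1 / real h / sqrt h"
      using False by (simp add: field_simps power2_eq_square)
    finally show ?thesis by (simp only:) (intro divide_right_mono, auto simp: weight_def)
  qed simp
  show s: "summable (\<lambda>h. weight H h / sqrt h)"
    by (rule summable_comparison_test'[OF weight_sqrt_sum(1)[of 1]]) (use b weight_nonneg in auto)
  have "(\<Sum>h. weight H h / sqrt h) \<le> (\<Sum>h. weight 1 h * sqrt h)"
    by (rule suminf_le[OF b s weight_sqrt_sum(1)]) simp
  then show "(\<Sum>h. weight H h / sqrt h) \<le> 4" using weight_sqrt_sum(2)[of 1] by simp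
qed

text \<open>There are at most V / l + 2 terms. For l > 1 this alone suffices; otherwise
  \<open>sum_saw_bound\<close> is applied with the harmonic bounds.\<close>

lemma sum_saw_van_der_corput:
  fixes w :: "nat \<Rightarrow> real" and l V x :: real
  assumes inc: "\<And>n. a \<le> n \<Longrightarrow> n + 2 < b \<Longrightarrow> w (n + 1) - w n + l \<le> w (n + 2) - w (n + 1)"
    and rng: "\<And>n. a \<le> n \<Longrightarrow> n + 1 < b \<Longrightarrow> x \<le> w (n + 1) - w n \<and> w (n + 1) - w n \<le> x + V"
    and l: "0 < l" and V: "0 \<le> V" and ab: "a < b"
  shows "\<bar>\<Sum>n\<in>{a..<b}. saw (w n)\<bar> \<le> 41 * (V * l powr (- 2 / 3)) + 44 * l powr (- 1 / 2) + 17"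
proof -
  have N: "real (b - a) \<le> V / l + 2"
  proof -
    have "real (card {a..<b-1}) \<le> V / l + 1"
      by (rule card_growing_in_interval[where a = a and b = "b-1" and D = "\<lambda>n. w (n + 1) - w n" and x = x])
         (use inc rng l V in auto)
    then show ?thesis using ab by simp
  qed
  have Vl: "V * l powr (- 2 / 3) \<ge> 0" "l powr (- 1 / 2) \<ge> 0" using V by auto
  have lp: "1 / l * l powr (1 / 3) = l powr (- 2 / 3)"
    using powr_add[of l "-1" "1/3"] l by (simp add: powr_minus_divide)
  show ?thesis
  proof (cases "l \<le> 1")
    case False
    have "\<bar>\<Sum>n\<in>{a..<b}. saw (w n)\<bar> \<le> (\<Sum>n\<in>{a..<b}. 1)"
      by (intro order.trans[OF sum_abs] sum_mono order.trans[OF abs_saw_le]) simp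
    then have "\<bar>\<Sum>n\<in>{a..<b}. saw (w n)\<bar> \<le> V / l + 2" using N by simp
    also have "V / l \<le> V * l powr (- 2 / 3)"
    proof -
      have "1 / l * 1 \<le> 1 / l * l powr (1 / 3)"
        using False by (intro mult_left_mono ge_one_powr_ge_zero) auto
      then show ?thesis unfolding lp using mult_left_mono[of "1/l" "l powr (-2/3)" V] V by simp
    qed
    finally show ?thesis using Vl by linarith
  next
    case True
    \<comment> \<open>This size of H balances V / (l H), from the number of terms, with V sqrt(H /
      l), from the exponential sums; both become V l^(-2/3).\<close>
    define H where "H = nat \<lceil>l powr (- 1 / 3)\<rceil>"
    have l1: "1 \<le> l powr (- 1 / 3)"
    proof -
      have "1 powr (- 1 / 3) \<le> l powr (- 1 / 3)" by (rule powr_mono2') (use l True in auto)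
      then show ?thesis unfolding powr_one_eq_one .
    qed
    have H: "l powr (- 1 / 3) \<le> H" "H \<le> 2 * l powr (- 1 / 3)" "0 < H"
    proof -
      have "real H = real_of_int \<lceil>l powr (- 1 / 3)\<rceil>"
        unfolding H_def using l1 by (intro of_nat_nat) linarith
      then show "l powr (- 1 / 3) \<le> H" "H \<le> 2 * l powr (- 1 / 3)"
        using l1 ceiling_correct[of "l powr (- 1 / 3)"] by linarith+
      with l1 have "real H > 0" by linarith
      then show "0 < H" by simp
    qed
    \<comment> \<open>The harmonic bound sorted by its dependence on h: P multiplies sqrt h and Q
      multiplies 1 / sqrt h, the two weighted sums already evaluated.\<close>
    define P where "P = 5 * V / sqrt l + 2 * sqrt l"
    define Q where "Q = 11 / sqrt l"
    have PQ: "0 \<le> P" "0 \<le> Q" unfolding P_def Q_def using V l by auto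
    define F where "F h = P * sqrt h + Q / sqrt h" for h :: nat
    have wF: "weight H h * F h = P * (weight H h * sqrt h) + Q * (weight H h / sqrt h)" for h
      by (simp add: F_def algebra_simps)
    have "(\<lambda>h. weight H h * F h) sums (P * (\<Sum>h. weight H h * sqrt h) + Q * (\<Sum>h. weight H h / sqrt h))"
      unfolding wF by (intro sums_add sums_mult summable_sums weight_sqrt_sum weight_inverse_sqrt_sum H)
    then have sm: "summable (\<lambda>h. weight H h * F h)"
      and sv: "(\<Sum>h. weight H h * F h) = P * (\<Sum>h. weight H h * sqrt h) + Q * (\<Sum>h. weight H h / sqrt h)"
      by (auto simp: sums_iff)
    have "\<bar>\<Sum>n\<in>{a..<b}. saw (w n)\<bar> \<le> card {a..<b} / (2 * H) + (\<Sum>h. weight H h * F h)"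
    proof (rule sum_saw_bound[OF H(3) _ sm])
      fix h :: nat assume h: "0 < h"
      show "norm (\<Sum>n = a..<b. cis (2 * pi * (real h * w n))) \<le> F h"
        using van_der_corput_harmonic[OF inc rng l V h ab] h l
        by (simp add: F_def P_def Q_def real_sqrt_mult field_simps)
    qed
    also have "(\<Sum>h. weight H h * F h) \<le> P * (4 * sqrt H) + Q * 4"
      unfolding sv using PQ weight_sqrt_sum(2)[OF H(3)] weight_inverse_sqrt_sum(2)[of H]
      by (intro add_mono mult_left_mono)
    also have "real (card {a..<b}) / (2 * H) \<le> (V / l + 2) * (l powr (1 / 3) / 2)"
    proof -
      have "1 / (2 * H) \<le> l powr (1 / 3) / 2"
        using H l by (simp add: powr_minus field_simps)
      then have "real (b - a) * (1 / (2 * H)) \<le> (V / l + 2) * (l powr (1 / 3) / 2)"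
        using N by (intro mult_mono) auto
      then show ?thesis by simp
    qed
    also have "\<dots> \<le> V * l powr (- 2 / 3) + 1"
    proof -
      have "l powr (1 / 3) \<le> 1" using l True by (simp add: powr_le1)
      moreover have "(V / l + 2) * (l powr (1 / 3) / 2) = V * (1 / l * l powr (1 / 3)) / 2 + l powr (1/3)"
        by (simp add: algebra_simps add_divide_distrib)
      ultimately show ?thesis unfolding lp using Vl by simp
    qed
    also have "P * (4 * sqrt H) \<le> 40 * (V * l powr (- 2 / 3)) + 16"
    proof -
      have "sqrt H \<le> sqrt (4 * l powr (- 1 / 3))" using H l1 by (simp only: real_sqrt_le_iff)
      also have "\<dots> = 2 * l powr (- 1 / 6)"
        by (simp add: real_sqrt_mult powr_half_sqrt[symmetric] powr_powr)
      finally have "P * (4 * sqrt H) \<le> P * (4 * (2 * l powr (- 1 / 6)))" using PQ by (intro mult_left_mono) auto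
      also have "\<dots> = 40 * (V * (l powr (- 1 / 2) * l powr (- 1 / 6))) + 16 * (l powr (1 / 2) * l powr (- 1 / 6))"
        using l by (simp add: P_def powr_half_sqrt powr_minus field_simps)
      also have "l powr (- 1 / 2) * l powr (- 1 / 6) = l powr (- 2 / 3)" by (simp flip: powr_add)
      also have "l powr (1 / 2) * l powr (- 1 / 6) = l powr (1 / 3)" by (simp flip: powr_add)
      also have "l powr (1 / 3) \<le> 1" using l True by (simp add: powr_le1)
      finally show ?thesis by simp
    qed
    finally have "\<bar>\<Sum>n\<in>{a..<b}. saw (w n)\<bar> \<le> 41 * (V * l powr (- 2 / 3)) + 17 + Q * 4" by simp
    moreover have "Q = 11 * l powr (- 1 / 2)" using l by (simp add: Q_def powr_minus powr_half_sqrt field_simps)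
    ultimately show ?thesis by simp
  qed
qed

section \<open>The curve\<close>

locale p_curve =
  fixes p :: real
  assumes p: "0 < p" "p < 1"
begin

text \<open>Truncation extends the curve by zero past 1, so it stays continuous and antitone on the
  half-line and sums or integrals may overshoot 1.\<close>

definition f :: "real \<Rightarrow> real" where "f x = (max 0 (1 - x powr p)) powr (1 / p)"

definition df :: "real \<Rightarrow> real" where
  "df x = - (x powr (p - 1) * (1 - x powr p) powr (1 / p - 1))"

definition \<alpha> :: real where "\<alpha> = (1 / 2) powr (1 / p)"

lemma \<alpha>_powr: "\<alpha> powr p = 1 / 2" using p by (simp add: \<alpha>_def powr_powr)

lemma \<alpha>_bounds: "0 < \<alpha>" "\<alpha> < 1"
proof -
  show "0 < \<alpha>" by (simp add: \<alpha>_def)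
  have "(1 / 2) powr (1 / p) < (1::real) powr (1 / p)" using p by (intro powr_less_mono2) auto
  then show "\<alpha> < 1" by (simp add: \<alpha>_def)
qed

lemma f_\<alpha>: "f \<alpha> = \<alpha>" unfolding f_def \<alpha>_powr by (simp add: \<alpha>_def)

lemma f_0: "f 0 = 1" using p by (simp add: f_def)

lemma f_nonneg: "0 \<le> f x" by (simp add: f_def)

lemma f_antimono:
  assumes "0 \<le> x" "x \<le> y" shows "f y \<le> f x"
proof -
  have "x powr p \<le> y powr p" using assms p by (intro powr_mono2) auto
  then show ?thesis unfolding f_def using p by (intro powr_mono2) auto
qed

lemma powr_less_1: "0 \<le> x \<Longrightarrow> x < 1 \<Longrightarrow> x powr p < 1"
  using powr_less_mono2[of p x 1] p by simp

lemma f_strict_antimono: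
  assumes "0 \<le> x" "x < y" "y \<le> 1" shows "f y < f x"
proof -
  have "x powr p < y powr p" using assms p by (intro powr_less_mono2) auto
  moreover have "y powr p \<le> 1" using powr_mono2[of p y 1] assms p by simp
  ultimately show ?thesis unfolding f_def using p by (intro powr_less_mono2) auto
qed

lemma f_continuous: "continuous_on {0..} f"
proof -
  have "continuous_on {0..} (\<lambda>x::real. x powr p)" using p by (intro continuous_on_powr') (auto intro: continuous_intros)
  then have "continuous_on {0..} (\<lambda>x. max 0 (1 - x powr p))"
    by (intro continuous_on_max continuous_on_diff continuous_on_const)
  then show ?thesis unfolding f_def[abs_def] using p
    by (intro continuous_on_powr') (auto intro: continuous_intros)
qed

lemma f_continuous': "0 \<le> a \<Longrightarrow> continuous_on {a..b} f"
  by (rule continuous_on_subset[OF f_continuous]) auto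

lemma f_deriv:
  assumes "0 < x" "x < 1"
  shows "(f has_real_derivative df x) (at x)"
proof -
  have l: "x powr p < 1" using powr_less_1 assms by simp
  have "((\<lambda>x. (1 - x powr p) powr (1 / p)) has_real_derivative
     (1 / p) * (1 - x powr p) powr (1 / p - 1) * (- (p * x powr (p - 1)))) (at x)"
    using l assms by (auto intro!: derivative_eq_intros)
  also have "(1 / p) * (1 - x powr p) powr (1 / p - 1) * (- (p * x powr (p - 1))) = df x"
    using p by (simp add: df_def)
  finally have d: "((\<lambda>x. (1 - x powr p) powr (1 / p)) has_real_derivative df x) (at x)" .
  have "\<forall>\<^sub>F y in nhds x. y \<in> {0<..<1}" using assms by (intro eventually_nhds_in_open) auto
  then have ev: "\<forall>\<^sub>F y in nhds x. (1 - y powr p) powr (1 / p) = f y"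
    by eventually_elim (use powr_less_1 in \<open>auto simp: f_def max_def less_imp_le\<close>)
  show ?thesis by (rule DERIV_cong_ev[OF refl ev refl, THEN iffD1, OF d])
qed

lemma df_nonpos: "df x \<le> 0" by (simp add: df_def)

lemma df_bound:
  assumes "0 < x" "x < 1"
  shows "- (x powr (p - 1)) \<le> df x"
proof -
  have "(1 - x powr p) powr (1 / p - 1) \<le> 1 powr (1 / p - 1)"
    using p powr_less_1[of x] assms by (intro powr_mono2) auto
  then show ?thesis unfolding df_def using mult_left_mono[of _ 1 "x powr (p - 1)"] by simp
qed

text \<open>Both factors of -\<open>df\<close> decrease in x; only the change of the power x^(p-1)
  is retained.\<close>

lemma df_increment:
  assumes "0 < x" "x \<le> y" "y < 1"
  shows "df y - df x \<ge> (x powr (p - 1) - y powr (p - 1)) * (1 - y powr p) powr (1 / p - 1)"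
proof -
  have "(1 - y powr p) powr (1 / p - 1) \<le> (1 - x powr p) powr (1 / p - 1)"
    using p powr_less_1[of y] powr_mono2[of p x y] assms by (intro powr_mono2) auto
  then have "x powr (p - 1) * (1 - y powr p) powr (1 / p - 1) \<le> x powr (p - 1) * (1 - x powr p) powr (1 / p - 1)"
    by (intro mult_left_mono) auto
  then show ?thesis unfolding df_def by (simp add: algebra_simps)
qed

lemma df_mono:
  assumes "0 < x" "x \<le> y" "y < 1" shows "df x \<le> df y"
proof -
  have "y powr (p - 1) \<le> x powr (p - 1)" using assms p by (intro powr_mono2') auto
  then have "0 \<le> (x powr (p - 1) - y powr (p - 1)) * (1 - y powr p) powr (1 / p - 1)" by simp
  then show ?thesis using df_increment[OF assms] by linarith
qed

text \<open>The factor 1 - p comes from differentiating x^(p-1). The factor \<alpha> bounds (1 -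
  x^p)^(1/p - 1) from below up to the cut, where that expression equals 2 \<alpha>.\<close>

definition \<kappa> :: real where "\<kappa> = (1 - p) * \<alpha>"

lemma \<kappa>_pos: "0 < \<kappa>" using p \<alpha>_bounds by (simp add: \<kappa>_def)

text \<open>Replaces a lower bound for the second derivative.\<close>

lemma df_increment_lower:
  assumes "0 < x" "x < y" "y \<le> \<alpha>"
  shows "df y - df x \<ge> \<kappa> * y powr (p - 2) * (y - x)"
proof -
  have y1: "y < 1" using assms \<alpha>_bounds by simp
  obtain z where z: "x < z" "z < y" and
    zeq: "y powr (p - 1) - x powr (p - 1) = (y - x) * ((p - 1) * z powr (p - 1 - 1))"
  proof -
    have "((\<lambda>z. z powr (p - 1)) has_real_derivative (p - 1) * z powr (p - 1 - 1)) (at z)" if "x \<le> z" for z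
      using has_real_derivative_powr[of z "p - 1"] that assms(1) by simp
    then show thesis
      using MVT2[OF assms(2), of "\<lambda>z. z powr (p - 1)" "\<lambda>z. (p - 1) * z powr (p - 1 - 1)"] that by blast
  qed
  have "y powr (p - 2) \<le> z powr (p - 2)" using z assms p by (intro powr_mono2') auto
  then have "(1 - p) * y powr (p - 2) * (y - x) \<le> (1 - p) * z powr (p - 2) * (y - x)"
    using p assms by (intro mult_right_mono mult_left_mono) auto
  also have "\<dots> = x powr (p - 1) - y powr (p - 1)" using zeq by (simp add: algebra_simps)
  finally have 1: "(1 - p) * y powr (p - 2) * (y - x) \<le> x powr (p - 1) - y powr (p - 1)" .
  have "y powr p \<le> 1 / 2" using powr_mono2[of p y \<alpha>] \<alpha>_powr assms p by simp
  then have "(1 / 2) powr (1 / p - 1) \<le> (1 - y powr p) powr (1 / p - 1)"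
    using p by (intro powr_mono2) auto
  moreover have "(1 / 2) powr (1 / p - 1) = 2 * \<alpha>" by (simp add: \<alpha>_def powr_diff)
  ultimately have 2: "\<alpha> \<le> (1 - y powr p) powr (1 / p - 1)" using \<alpha>_bounds by linarith
  have "(1 - p) * y powr (p - 2) * (y - x) * \<alpha> \<le> (x powr (p - 1) - y powr (p - 1)) * (1 - y powr p) powr (1 / p - 1)"
  proof (rule mult_mono[OF 1 2])
    show "0 \<le> x powr (p - 1) - y powr (p - 1)" using assms p by (simp add: powr_mono2')
  qed (use \<alpha>_bounds in simp)
  then show ?thesis using df_increment[of x y] assms y1 by (simp add: \<kappa>_def mult_ac)
qed

section \<open>Second differences and sawtooth sums along the curve\<close>

lemma f_mvt:
  assumes "0 < x" "x < y" "y < 1"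
  shows "\<exists>z. x < z \<and> z < y \<and> f y - f x = (y - x) * df z"
  using MVT2[OF assms(2), of f df] f_deriv assms by force

text \<open>The mean value theorem for t \<mapsto> f(t + h) - f(t) turns the second difference into
  h times an increment of \<open>df\<close> over a step h.\<close>

lemma f_second_difference:
  assumes "0 < x" "0 < h" "x + 2 * h \<le> \<alpha>"
  shows "f (x + 2 * h) - 2 * f (x + h) + f x \<ge> \<kappa> * h\<^sup>2 * (x + 2 * h) powr (p - 2)"
proof -
  have lt: "x + 2 * h < 1" using assms \<alpha>_bounds by simp
  have "\<exists>z. x < z \<and> z < x + h \<and> (f (x + h + h) - f (x + h)) - (f (x + h) - f x) = (x + h - x) * (df (z + h) - df z)"
  proof (rule MVT2[where f = "\<lambda>t. f (t + h) - f t"])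
    fix t assume t: "x \<le> t" "t \<le> x + h"
    have "((\<lambda>t. f (t + h)) has_real_derivative df (t + h)) (at t)"
      using f_deriv[of "t + h"] t assms lt by (simp add: DERIV_shift)
    then show "((\<lambda>t. f (t + h) - f t) has_real_derivative df (t + h) - df t) (at t)"
      using f_deriv[of t] t assms lt by (intro DERIV_diff) auto
  qed (use assms in simp)
  then obtain z where z: "x < z" "z < x + h" and
    eq0: "(f (x + h + h) - f (x + h)) - (f (x + h) - f x) = (x + h - x) * (df (z + h) - df z)"
    by blast
  have "x + h + h = x + 2 * h" by simp
  with eq0 have eq: "f (x + 2 * h) - 2 * f (x + h) + f x = h * (df (z + h) - df z)" by simp
  have "\<kappa> * (x + 2 * h) powr (p - 2) * h \<le> \<kappa> * (z + h) powr (p - 2) * h"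
    using z assms p \<kappa>_pos by (intro mult_right_mono mult_left_mono powr_mono2') auto
  also have "\<dots> \<le> df (z + h) - df z" using df_increment_lower[of z "z + h"] z assms by simp
  finally have "h * (\<kappa> * (x + 2 * h) powr (p - 2) * h) \<le> h * (df (z + h) - df z)"
    using assms by (intro mult_left_mono) auto
  then show ?thesis unfolding eq by (simp add: power2_eq_square mult_ac)
qed

text \<open>Above half of y = m / R, slope and curvature are controlled by their size at y: up to
  constants, V is y^(p-1) and l is y^(p-2) / R. So V l^(-2/3) is of order R^(2/3) y^((p+1)/3), and
  dropping the surplus y^(p/3) \<le> 1 leaves (R m)^(1/3) = R^(2/3) y^(1/3). The bound \<Gamma> on
  the ratio of R and S enters only the constant.\<close>

lemma saw_block:
  fixes R S \<Gamma> :: real and m :: nat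
  assumes m: "0 < m" "m \<le> \<alpha> * R" and S: "0 < S" and \<Gamma>: "1 \<le> \<Gamma>" "S \<le> \<Gamma> * R" "R \<le> \<Gamma> * S"
  shows "\<bar>\<Sum>n\<in>{m div 2 + 1..<m + 1}. saw (S * f (n / R))\<bar> \<le>
    (82 * \<Gamma> * \<kappa> powr (- 2 / 3) + 44 * \<Gamma> * \<kappa> powr (- 1 / 2) + 17) * (R * m) powr (1 / 3)"
proof -
  define \<rho> where "\<rho> = S / R"
  define y where "y = m / R"
  define l where "l = \<rho> * \<kappa> * (1 / R) * y powr (p - 2)"
  define V where "V = \<rho> * (y / 2) powr (p - 1)"
  have R: "1 \<le> R"
  proof -
    have "1 \<le> \<alpha> * R" using m by linarith
    moreover from this have "0 < R" using \<alpha>_bounds(1) zero_less_mult_pos[of \<alpha> R] by linarith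
    moreover from this have "\<alpha> * R \<le> 1 * R" using \<alpha>_bounds by (intro mult_right_mono) auto
    ultimately show ?thesis by simp
  qed
  have \<rho>: "0 < \<rho>" "\<rho> \<le> \<Gamma>" "1 / \<Gamma> \<le> \<rho>"
    unfolding \<rho>_def using R S \<Gamma> by (auto simp: field_simps)
  have y: "0 < y" "y \<le> \<alpha>" using m R unfolding y_def by (auto simp: field_simps)
  then have y1: "y < 1" using \<alpha>_bounds by simp
  note y = y y1
  have l: "0 < l" unfolding l_def using \<rho> \<kappa>_pos R y by simp
  have V: "0 \<le> V" unfolding V_def using \<rho> by simp
  have main: "\<bar>\<Sum>n\<in>{m div 2 + 1..<m + 1}. saw (S * f (n / R))\<bar> \<le> 41 * (V * l powr (- 2 / 3)) + 44 * l powr (- 1 / 2) + 17"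
  proof (rule sum_saw_van_der_corput[where x = "- V"])
    fix n assume n: "m div 2 + 1 \<le> n"
    \<comment> \<open>Starting at \<open>m div 2 + 1\<close> keeps n at or above m / 2 for odd m
      too.\<close>
    then have n2: "real m / 2 \<le> real n" and n0: "0 < n" by linarith+
    show "S * f ((n + 1) / R) - S * f (n / R) + l \<le> S * f ((n + 2) / R) - S * f ((n + 1) / R)"
      if "n + 2 < m + 1"
    proof -
      define x where "x = n / R"
      define h where "h = 1 / R"
      have eqs: "real (n + 1) / R = x + h" "real (n + 2) / R = x + 2 * h"
        using R by (auto simp: x_def h_def field_simps)
      have "real (n + 2) \<le> m" using that by linarith
      then have le: "x + 2 * h \<le> y" unfolding eqs[symmetric] y_def using R by (intro divide_right_mono) auto
      have xh: "0 < x" "0 < h" unfolding x_def h_def using R n0 by auto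
      have "\<kappa> * h\<^sup>2 * y powr (p - 2) \<le> \<kappa> * h\<^sup>2 * (x + 2 * h) powr (p - 2)"
        using le xh \<kappa>_pos p by (intro mult_left_mono powr_mono2') auto
      also have "\<dots> \<le> f (x + 2 * h) - 2 * f (x + h) + f x"
        using f_second_difference[of x h] xh le y by simp
      finally have "S * (\<kappa> * h\<^sup>2 * y powr (p - 2)) \<le> S * (f (x + 2 * h) - 2 * f (x + h) + f x)"
        using S by (intro mult_left_mono) auto
      moreover have "S * (\<kappa> * h\<^sup>2 * y powr (p - 2)) = l"
        unfolding l_def \<rho>_def h_def by (simp add: power2_eq_square)
      ultimately show ?thesis unfolding eqs x_def[symmetric] by (simp add: algebra_simps)
    qed
    show "- V \<le> S * f ((n + 1) / R) - S * f (n / R) \<and> S * f ((n + 1) / R) - S * f (n / R) \<le> - V + V"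
      if "n + 1 < m + 1"
    proof -
      define x where "x = n / R"
      define h where "h = 1 / R"
      have eqs: "real (n + 1) / R = x + h"
        using R by (auto simp: x_def h_def field_simps)
      have "real (n + 1) \<le> m" using that by linarith
      then have le: "x + h \<le> y" unfolding eqs[symmetric] y_def using R by (intro divide_right_mono) auto
      have xh: "0 < x" "0 < h" "y / 2 \<le> x" unfolding x_def h_def y_def using R n0 n2 by (auto simp: field_simps)
      obtain z where z: "x < z" "z < x + h" and eq: "f (x + h) - f x = (x + h - x) * df z"
        using f_mvt[of x "x + h"] xh le y by auto
      have "- ((y / 2) powr (p - 1)) \<le> - (z powr (p - 1))"
        using z xh y p by (simp add: powr_mono2')
      also have "\<dots> \<le> df z" using df_bound[of z] z xh le y by simp
      finally have b: "- ((y / 2) powr (p - 1)) \<le> df z" .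
      have e: "S * f (x + h) - S * f x = \<rho> * df z"
        using eq by (simp add: \<rho>_def h_def flip: right_diff_distrib)
      have "\<rho> * (- ((y / 2) powr (p - 1))) \<le> \<rho> * df z" "\<rho> * df z \<le> 0"
        using mult_left_mono[OF b, of \<rho>] mult_left_mono[OF df_nonpos[of z], of \<rho>] \<rho> by auto
      then show ?thesis unfolding eqs x_def[symmetric] e V_def by simp
    qed
  qed (use l V m in auto)
  define Z where "Z = (R * m) powr (1 / 3)"
  have Zy: "Z = R powr (2 / 3) * y powr (1 / 3)"
  proof -
    have "R * m = R powr 2 * y" unfolding y_def using R by (simp add: power2_eq_square)
    then show ?thesis unfolding Z_def by (simp only: powr_mult powr_powr) simp
  qed
  \<comment> \<open>Needed to absorb the additive constant 17 into the multiple of Z.\<close>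
  have Z1: "1 \<le> Z" unfolding Z_def
  proof (rule ge_one_powr_ge_zero)
    show "1 \<le> R * m" using mult_mono[of 1 R 1 "real m"] R m by simp
  qed simp
  have "V * l powr (- 2 / 3) \<le> 2 * \<Gamma> * \<kappa> powr (- 2 / 3) * Z"
  proof -
    have "V * l powr (- 2 / 3) = (\<rho> * \<rho> powr (- 2 / 3)) * \<kappa> powr (- 2 / 3) * (1 / R) powr (- 2 / 3) *
        ((y / 2) powr (p - 1) * (y powr (p - 2)) powr (- 2 / 3))"
      unfolding V_def l_def powr_mult by (simp only: mult_ac)
    also have "\<rho> * \<rho> powr (- 2 / 3) = \<rho> powr (1 / 3)" using \<rho> by (simp add: powr_mult_base)
    also have "(1 / R) powr (- 2 / 3) = R powr (2 / 3)" using R by (simp add: powr_divide powr_minus_divide)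
    also have "(y / 2) powr (p - 1) * (y powr (p - 2)) powr (- 2 / 3) = 2 powr (1 - p) * y powr ((p + 1) / 3)"
    proof -
      have "(y / 2) powr (p - 1) = y powr (p - 1) * 2 powr (1 - p)"
        using y powr_minus_divide[of 2 "1 - p"] by (simp add: powr_divide)
      moreover have "y powr (p - 1) * (y powr (p - 2)) powr (- 2 / 3) = y powr ((p + 1) / 3)"
        by (simp add: powr_powr field_simps flip: powr_add)
      ultimately show ?thesis by (simp add: mult_ac)
    qed
    finally have "V * l powr (- 2 / 3) = \<rho> powr (1 / 3) * \<kappa> powr (- 2 / 3) * R powr (2 / 3) * (2 powr (1 - p) * y powr ((p + 1) / 3))" .
    also have "\<dots> \<le> \<Gamma> * \<kappa> powr (- 2 / 3) * R powr (2 / 3) * (2 * y powr (1 / 3))"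
    proof (intro mult_mono mult_right_mono)
      have "\<rho> powr (1 / 3) \<le> \<Gamma> powr (1 / 3)" using \<rho> by (intro powr_mono2) auto
      also have "\<dots> \<le> \<Gamma> powr 1" using \<Gamma> by (intro powr_mono) auto
      finally show "\<rho> powr (1 / 3) \<le> \<Gamma>" using \<Gamma> by simp
      show "2 powr (1 - p) \<le> (2::real)" using powr_mono[of "1 - p" 1 "2::real"] p by simp
      show "y powr ((p + 1) / 3) \<le> y powr (1 / 3)" using y p by (intro powr_mono') auto
    qed (use \<Gamma> in auto)
    finally show ?thesis unfolding Zy by (simp add: mult_ac)
  qed
  moreover have "l powr (- 1 / 2) \<le> \<Gamma> * \<kappa> powr (- 1 / 2) * Z"
  proof -
    have "l powr (- 1 / 2) = \<rho> powr (- 1 / 2) * \<kappa> powr (- 1 / 2) * (1 / R) powr (- 1 / 2) * (y powr (p - 2)) powr (- 1 / 2)"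
      unfolding l_def by (simp only: powr_mult)
    also have "(1 / R) powr (- 1 / 2) = R powr (1 / 2)" using R by (simp add: powr_divide powr_minus_divide)
    also have "(y powr (p - 2)) powr (- 1 / 2) = y powr (1 - p / 2)"
    proof -
      have "(p - 2) * (- 1 / 2) = 1 - p / 2" by (simp add: field_simps)
      then show ?thesis by (simp only: powr_powr)
    qed
    also have "\<rho> powr (- 1 / 2) * \<kappa> powr (- 1 / 2) * R powr (1 / 2) * y powr (1 - p / 2)
      \<le> \<Gamma> * \<kappa> powr (- 1 / 2) * R powr (2 / 3) * y powr (1 / 3)"
    proof (intro mult_mono)
      have "\<rho> powr (- 1 / 2) \<le> (1 / \<Gamma>) powr (- 1 / 2)" using \<rho> \<Gamma> by (intro powr_mono2') auto
      also have "\<dots> = \<Gamma> powr (1 / 2)" using \<Gamma> by (simp add: powr_divide powr_minus_divide)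
      also have "\<dots> \<le> \<Gamma> powr 1" using \<Gamma> by (intro powr_mono) auto
      finally show "\<rho> powr (- 1 / 2) \<le> \<Gamma>" using \<Gamma> by simp
      show "R powr (1 / 2) \<le> R powr (2 / 3)" using R by (intro powr_mono) auto
      show "y powr (1 - p / 2) \<le> y powr (1 / 3)" using y p by (intro powr_mono') auto
    qed (use \<Gamma> in auto)
    finally show ?thesis unfolding Zy by (simp add: mult_ac)
  qed
  ultimately show ?thesis using main Z1 unfolding Z_def[symmetric] by (simp add: algebra_simps)
qed

text \<open>The curvature is unbounded near 0, so the range is cut into the dyadic blocks of
  \<open>saw_block\<close>, whose bounds add up geometrically.\<close>

lemma saw_sum:
  fixes R S \<Gamma> K :: real and m :: nat
  assumes S: "0 < S" and \<Gamma>: "1 \<le> \<Gamma>" "S \<le> \<Gamma> * R" "R \<le> \<Gamma> * S" and R: "0 < R"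
  defines "K \<equiv> 82 * \<Gamma> * \<kappa> powr (- 2 / 3) + 44 * \<Gamma> * \<kappa> powr (- 1 / 2) + 17"
  shows "m \<le> \<alpha> * R \<Longrightarrow> \<bar>\<Sum>n\<in>{1..<m + 1}. saw (S * f (n / R))\<bar> \<le> 5 * K * (R * m) powr (1 / 3)"
proof (induction m rule: less_induct)
  case (less m)
  have K: "0 \<le> K" unfolding K_def using \<Gamma> by simp
  show ?case
  proof (cases "m = 0")
    case False
    then have m0: "0 < m" by simp
    define k where "k = m div 2"
    have k: "k < m" "real k \<le> m / 2" using m0 unfolding k_def by linarith+
    define Z where "Z = (R * m) powr (1 / 3)"
    have Z: "0 \<le> Z" unfolding Z_def by simp
    have IH: "\<bar>\<Sum>n\<in>{1..<k + 1}. saw (S * f (n / R))\<bar> \<le> 5 * K * (R * k) powr (1 / 3)"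
      by (rule less.IH) (use k less.prems in auto)
    have "(R * k) powr (1 / 3) \<le> (R * m * (1 / 2)) powr (1 / 3)"
      using k R by (intro powr_mono2) (auto simp: field_simps)
    also have "\<dots> = Z * (1 / 2) powr (1 / 3)" unfolding Z_def by (rule powr_mult)
    also have "\<dots> \<le> Z * (4 / 5)"
    proof (rule mult_left_mono[OF _ Z])
      \<comment> \<open>Halving m saves a factor at most 4/5, since (4/5)^3 = 0.512. Hence the
        constant 5: K + (4/5) 5 K = 5 K.\<close>
      have "(1 / 2) powr (1 / 3) \<le> ((4 / 5) powr 3) powr (1 / 3 :: real)" by (intro powr_mono2) (auto simp: power3_eq_cube)
      also have "\<dots> = 4 / 5" by (simp only: powr_powr) simp
      finally show "(1 / 2) powr (1 / 3) \<le> (4 / 5 :: real)" .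
    qed
    finally have "5 * K * (R * k) powr (1 / 3) \<le> 5 * K * (Z * (4 / 5))" using K by (intro mult_left_mono) auto
    moreover have "\<bar>\<Sum>n\<in>{k + 1..<m + 1}. saw (S * f (n / R))\<bar> \<le> K * Z"
      unfolding K_def Z_def k_def by (rule saw_block) (use m0 less.prems S \<Gamma> in auto)
    moreover have "(\<Sum>n\<in>{1..<m + 1}. saw (S * f (n / R))) =
      (\<Sum>n\<in>{1..<k + 1}. saw (S * f (n / R))) + (\<Sum>n\<in>{k + 1..<m + 1}. saw (S * f (n / R)))"
      by (rule sum.atLeastLessThan_concat[symmetric]) (use k in auto)
    ultimately show ?thesis using IH unfolding Z_def[symmetric] by linarith
  qed simp
qed

section \<open>The trapezoidal rule\<close>

lemma f_integrable: "0 \<le> a \<Longrightarrow> f integrable_on {a..b}"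
  by (intro integrable_continuous_real f_continuous')

lemma integral_f_bounds:
  assumes "0 \<le> a" "a \<le> b"
  shows "(b - a) * f b \<le> integral {a..b} f" and "integral {a..b} f \<le> (b - a) * f a"
proof -
  have "integral {a..b} (\<lambda>_. f b) \<le> integral {a..b} f"
    using assms by (intro integral_le f_integrable f_antimono) auto
  then show "(b - a) * f b \<le> integral {a..b} f" using assms by simp
  have "integral {a..b} f \<le> integral {a..b} (\<lambda>_. f a)"
    using assms by (intro integral_le f_integrable f_antimono) auto
  then show "integral {a..b} f \<le> (b - a) * f a" using assms by simp
qed

lemma integral_f_combine:
  assumes "0 \<le> a" "a \<le> b" "b \<le> c"
  shows "integral {a..c} f = integral {a..b} f + integral {b..c} f"
  using assms by (intro Henstock_Kurzweil_Integration.integral_combine[symmetric] f_integrable) auto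

lemma f_increment_bounds:
  assumes "0 < a" "a \<le> x" "x \<le> b" "b < 1"
  shows "df a * (x - a) \<le> f x - f a" and "f x - f a \<le> df b * (x - a)"
proof -
  have "df a * (x - a) \<le> f x - f a \<and> f x - f a \<le> df b * (x - a)"
  proof (cases "a = x")
    case False
    then obtain z where z: "a < z" "z < x" "f x - f a = (x - a) * df z"
      using f_mvt[of a x] assms by auto
    have "df a \<le> df z" "df z \<le> df b" using z assms by (auto intro!: df_mono)
    then show ?thesis using z mult_right_mono[of "df a" "df z" "x - a"] mult_right_mono[of "df z" "df b" "x - a"]
      by (auto simp: mult.commute)
  qed auto
  then show "df a * (x - a) \<le> f x - f a" and "f x - f a \<le> df b * (x - a)" by auto
qed

text \<open>By convexity f lies between the lines through (a, f a) with slopes \<open>df a\<close>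
  and \<open>df b\<close>. The integral and the trapezoid both lie between the integrals of these
  lines.\<close>

lemma trapezoid_cell:
  assumes "0 < a" "a \<le> b" "b < 1"
  shows "\<bar>integral {a..b} f - (b - a) * (f a + f b) / 2\<bar> \<le> (b - a)\<^sup>2 / 2 * (df b - df a)"
proof -
  have lin: "((\<lambda>x. f a + c * (x - a)) has_integral ((b - a) * f a + c * ((b - a)\<^sup>2 / 2))) {a..b}" for c
  proof -
    have "((\<lambda>x. f a + c * (x - a)) has_integral
      ((f a * b + c * ((b - a)\<^sup>2 / 2)) - (f a * a + c * ((a - a)\<^sup>2 / 2)))) {a..b}"
      using assms
      by (intro fundamental_theorem_of_calculus)
         (auto simp: has_real_derivative_iff_has_vector_derivative[symmetric] intro!: derivative_eq_intros)
    then show ?thesis by (simp add: algebra_simps)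
  qed
  have f: "(f has_integral integral {a..b} f) {a..b}" using f_integrable[of a b] assms by auto
  have 1: "(b - a) * f a + df a * ((b - a)\<^sup>2 / 2) \<le> integral {a..b} f"
    by (rule has_integral_le[OF lin f]) (use f_increment_bounds(1)[of a _ b] assms in force)
  have 2: "integral {a..b} f \<le> (b - a) * f a + df b * ((b - a)\<^sup>2 / 2)"
    by (rule has_integral_le[OF f lin]) (use f_increment_bounds(2)[of a _ b] assms in force)
  define q where "q = (b - a)\<^sup>2 / 2"
  define M where "M = (b - a) / 2 * (f b - f a)"
  have "(b - a) / 2 * (df a * (b - a)) \<le> M" "M \<le> (b - a) / 2 * (df b * (b - a))"
    using f_increment_bounds[of a b b] assms unfolding M_def by (auto intro!: mult_left_mono)
  moreover have "(b - a) / 2 * (c * (b - a)) = c * q" for c by (simp add: q_def power2_eq_square)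
  ultimately have "df a * q \<le> M" "M \<le> df b * q" by metis+
  moreover have "(b - a) * (f a + f b) / 2 = (b - a) * f a + M" by (simp add: M_def field_simps)
  moreover have "q * (df b - df a) = df b * q - df a * q" by (simp add: algebra_simps)
  ultimately have "\<bar>integral {a..b} f - (b - a) * (f a + f b) / 2\<bar> \<le> q * (df b - df a)"
    using 1 2 unfolding q_def[symmetric] by linarith
  then show ?thesis unfolding q_def .
qed

text \<open>The function x^p / p has derivative x^(p-1), which dominates -\<open>df\<close>; adding
  it to f gives an increasing function.\<close>

lemma one_minus_f_le:
  assumes "0 \<le> x" "x \<le> 1"
  shows "1 - f x \<le> x powr p / p"
proof (cases "x = 0")
  case False
  with assms have x: "0 < x" by simp
  have "f 0 + 0 powr p / p \<le> f x + x powr p / p"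
  proof (rule DERIV_nonneg_imp_increasing_open[OF assms(1)])
    fix y assume y: "0 < y" "y < x"
    have "((\<lambda>y. f y + y powr p / p) has_real_derivative (df y + y powr (p - 1))) (at y)"
      using f_deriv[of y] y assms p by (auto intro!: derivative_eq_intros)
    moreover have "0 \<le> df y + y powr (p - 1)" using df_bound[of y] y assms by simp
    ultimately show "\<exists>d. ((\<lambda>y. f y + y powr p / p) has_real_derivative d) (at y) \<and> 0 \<le> d" by blast
  next
    have "continuous_on {0..x} (\<lambda>x::real. x powr p)" using p
      by (intro continuous_on_powr') (auto intro: continuous_intros)
    then show "continuous_on {0..x} (\<lambda>y. f y + y powr p / p)"
      using p by (intro continuous_on_add continuous_on_divide f_continuous') auto
  qed
  then show ?thesis using p f_0 by simp
qed (simp add: f_0)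

text \<open>In the first cell the slope is unbounded, but integral and trapezoid both lie between h
  f(h) and h, the trapezoid in the middle, so the error is at most h (1 - f h) / 2. The errors of
  the remaining cells telescope in \<open>df\<close>.\<close>

lemma trapezoid_sum:
  assumes "0 < h" "1 \<le> m" "real m * h \<le> \<alpha>"
  shows "\<bar>integral {0..real m * h} f - h * (1 / 2 + (\<Sum>j=1..m. f (real j * h)) - f (real m * h) / 2)\<bar>
    \<le> h * (h powr p / (2 * p)) + h\<^sup>2 / 2 * (df (real m * h) - df h)"
  using assms(2,3)
proof (induction m rule: dec_induct)
  case base
  have h1: "h \<le> 1" using base \<alpha>_bounds by simp
  define F where "F = h * f h"
  define Q where "Q = h * (h powr p / p)"
  have "F \<le> integral {0..h} f" "integral {0..h} f \<le> h"
    using integral_f_bounds[of 0 h] assms(1) f_0 by (auto simp: F_def)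
  moreover have "h * (1 - f h) \<le> Q"
    unfolding Q_def using one_minus_f_le[of h] h1 assms(1) by (intro mult_left_mono) auto
  moreover have "h * (1 - f h) = h - F" "h * (1 / 2 + f h / 2) = h / 2 + F / 2"
    by (simp_all add: F_def algebra_simps)
  ultimately have "\<bar>integral {0..h} f - h * (1 / 2 + f h / 2)\<bar> \<le> Q / 2"
    by linarith
  then have "\<bar>integral {0..h} f - h * (1 / 2 + f h / 2)\<bar> \<le> h * (h powr p / (2 * p))"
    unfolding Q_def by (simp add: mult.commute)
  then show ?case by (simp add: algebra_simps)
next
  case (step m)
  define a where "a = real m * h"
  define b where "b = real (Suc m) * h"
  have ab: "0 < a" "a \<le> b" "b - a = h" "b \<le> \<alpha>"
    using step assms(1) unfolding a_def b_def by (auto simp: algebra_simps)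
  have b1: "b < 1" using ab \<alpha>_bounds by simp
  have IH: "\<bar>integral {0..a} f - h * (1 / 2 + (\<Sum>j=1..m. f (real j * h)) - f a / 2)\<bar>
    \<le> h * (h powr p / (2 * p)) + h\<^sup>2 / 2 * (df a - df h)"
    unfolding a_def by (rule step.IH) (use ab in \<open>simp add: a_def\<close>)
  have cell: "\<bar>integral {a..b} f - h * (f a + f b) / 2\<bar> \<le> h\<^sup>2 / 2 * (df b - df a)"
    using trapezoid_cell[of a b] ab b1 by simp
  have int: "integral {0..b} f = integral {0..a} f + integral {a..b} f"
    using integral_f_combine[of 0 a b] ab by simp
  have sm: "(\<Sum>j=1..Suc m. f (real j * h)) = (\<Sum>j=1..m. f (real j * h)) + f b"
    by (simp add: b_def)
  have e1: "h * (1 / 2 + ((\<Sum>j=1..m. f (real j * h)) + f b) - f b / 2) =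
     h * (1 / 2 + (\<Sum>j=1..m. f (real j * h)) - f a / 2) + h * (f a + f b) / 2" by (simp add: field_simps)
  have e2: "h\<^sup>2 / 2 * (df b - df h) = h\<^sup>2 / 2 * (df a - df h) + h\<^sup>2 / 2 * (df b - df a)"
    unfolding distrib_left[symmetric] by simp
  show ?case unfolding b_def[symmetric] sm int e1 e2 using IH cell by linarith
qed

definition half_area :: real where "half_area = integral {0..\<alpha>} f"

text \<open>The trapezoidal rule stops at the last grid point a before \<alpha>. Its endpoint
  correction is about \<alpha> / 2, and the leftover strip of width (\<alpha> R - m) / R contributes
  \<alpha> (\<alpha> R - m) after scaling by R. The first cell, the telescoped slopes and the
  replacement of f a by \<alpha> each cost O(R^(-p)).\<close>

lemma sum_f_asymptotic:
  fixes R :: real and m :: nat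
  assumes "1 \<le> \<alpha> * R"
  defines "m \<equiv> nat \<lfloor>\<alpha> * R\<rfloor>"
  shows "\<bar>(\<Sum>j=1..m. f (real j / R)) - (R * half_area - 1 / 2 + \<alpha> * (1 / 2 - (\<alpha> * R - m)))\<bar> \<le> 3 / p * R powr (- p)"
proof -
  define h where "h = 1 / R"
  have R: "0 < R" using assms(1) \<alpha>_bounds zero_less_mult_pos[of \<alpha> R] by linarith
  have h: "0 < h" "R * h = 1" using R by (auto simp: h_def)
  have m: "1 \<le> m" "m \<le> \<alpha> * R" "\<alpha> * R < m + 1"
    unfolding m_def using assms(1) by (auto simp: le_nat_floor le_nat_iff) linarith+
  define a where "a = m * h"
  define d where "d = \<alpha> * R - m"
  define E where "E = R powr (- p)"
  have E: "h powr p = E" unfolding h_def E_def using R by (simp add: powr_divide powr_minus_divide)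
  have ah: "h \<le> a" "a \<le> \<alpha>" "\<alpha> - a = d * h" "0 \<le> d" "d \<le> 1"
    unfolding a_def d_def using m h R by (auto simp: h_def field_simps)
  have a1: "a < 1" "0 < a" using ah h \<alpha>_bounds by auto
  have dfh: "- (h powr (p - 1)) \<le> df h" using df_bound[of h] h ah a1 by simp
  have dfa: "df h \<le> df a" "df a \<le> 0" using df_mono[of h a] h ah a1 df_nonpos by auto
  have hh: "h * h powr (p - 1) = E" using h powr_mult_base[of h "p - 1"] E by simp
  define s where "s = (\<Sum>j=1..m. f (real j * h))"
  have T: "\<bar>integral {0..a} f - h * (1 / 2 + s - f a / 2)\<bar> \<le> h * (E / (2 * p)) + h\<^sup>2 / 2 * (df a - df h)"
    unfolding a_def s_def E[symmetric] by (rule trapezoid_sum) (use h m ah in \<open>auto simp: a_def\<close>)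
  have "R * \<bar>integral {0..a} f - h * (1 / 2 + s - f a / 2)\<bar> \<le> R * (h * (E / (2 * p)) + h\<^sup>2 / 2 * (df a - df h))"
    using R by (intro mult_left_mono[OF T]) auto
  also have "\<dots> = (R * h) * (E / (2 * p)) + (R * h) * (h / 2 * (df a - df h))"
    by (simp only: distrib_left power2_eq_square) simp
  also have "\<dots> \<le> E / (2 * p) + E / 2"
  proof -
    have "h / 2 * (df a - df h) \<le> h / 2 * h powr (p - 1)"
      using dfh dfa h by (intro mult_left_mono) auto
    then show ?thesis using hh h by simp
  qed
  also have "R * \<bar>integral {0..a} f - h * (1 / 2 + s - f a / 2)\<bar> = \<bar>R * integral {0..a} f - (R * h) * (1 / 2 + s - f a / 2)\<bar>"
    using R abs_mult[of R "integral {0..a} f - h * (1 / 2 + s - f a / 2)"] by (simp add: right_diff_distrib mult.assoc)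
  finally have T': "\<bar>R * integral {0..a} f - (1 / 2 + s - f a / 2)\<bar> \<le> E / (2 * p) + E / 2" using h by simp
  \<comment> \<open>The distance from a to \<alpha> is at most h, and the slope there is at least
    -h^(p-1); the product has size h^p.\<close>
  have fa: "0 \<le> f a - \<alpha>" "f a - \<alpha> \<le> E"
  proof -
    have inc: "df a * (\<alpha> - a) \<le> f \<alpha> - f a" using f_increment_bounds(1)[of a \<alpha> \<alpha>] a1 ah \<alpha>_bounds by simp
    have "- df a * (\<alpha> - a) \<le> h powr (p - 1) * h"
      using ah dfh dfa h mult_right_mono[of d 1 h] by (intro mult_mono) auto
    then show "f a - \<alpha> \<le> E" using inc hh by (simp add: f_\<alpha> mult.commute)
    show "0 \<le> f a - \<alpha>" using f_antimono[of a \<alpha>] f_\<alpha> ah a1 by simp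
  qed
  have tail: "d * \<alpha> \<le> R * integral {a..\<alpha>} f" "R * integral {a..\<alpha>} f \<le> d * f a"
  proof -
    have Rd: "R * ((\<alpha> - a) * c) = d * c" for c
    proof -
      have "R * ((\<alpha> - a) * c) = (R * h) * (d * c)" unfolding ah(3) by (simp only: mult_ac)
      then show ?thesis using h by simp
    qed
    show "d * \<alpha> \<le> R * integral {a..\<alpha>} f"
      unfolding Rd[symmetric] using integral_f_bounds(1)[of a \<alpha>] ah a1 R
      by (intro mult_left_mono) (auto simp: f_\<alpha>)
    show "R * integral {a..\<alpha>} f \<le> d * f a"
      unfolding Rd[symmetric] using integral_f_bounds(2)[of a \<alpha>] ah a1 R
      by (intro mult_left_mono) auto
  qed
  have dE: "d * f a \<le> d * \<alpha> + E"
  proof -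
    have "d * (f a - \<alpha>) \<le> 1 * E" using ah fa by (intro mult_mono) auto
    then show ?thesis by (simp add: algebra_simps)
  qed
  have RI: "R * half_area = R * integral {0..a} f + R * integral {a..\<alpha>} f"
    unfolding half_area_def using integral_f_combine[of 0 a \<alpha>] ah a1 by (simp add: distrib_left)
  have E0: "0 \<le> E" unfolding E_def by simp
  have fin: "E / (2 * p) + E / 2 + 2 * E \<le> 3 / p * E"
  proof -
    have "E * p \<le> E * 1" using p E0 by (intro mult_left_mono) auto
    then have "E \<le> E / p" using p by (simp add: pos_le_divide_eq)
    moreover have "E / (2 * p) = (E / p) / 2" "3 / p * E = 3 * (E / p)" by simp_all
    ultimately show ?thesis by linarith
  qed
  have "\<alpha> * (1 / 2 - d) = \<alpha> / 2 - d * \<alpha>" by (simp add: algebra_simps)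
  then have "\<bar>s - (R * half_area - 1 / 2 + \<alpha> * (1 / 2 - d))\<bar> \<le> 3 / p * E"
    using T' fa tail dE RI fin by linarith
  moreover have "s = (\<Sum>j=1..m. f (real j / R))" by (simp add: s_def h_def)
  ultimately show ?thesis unfolding d_def E_def by simp
qed

section \<open>Counting lattice points\<close>

lemma le_f_iff:
  assumes "0 < y"
  shows "x powr p + y powr p \<le> 1 \<longleftrightarrow> y \<le> f x"
proof
  assume "x powr p + y powr p \<le> 1"
  then have "(y powr p) powr (1 / p) \<le> f x" unfolding f_def using p by (intro powr_mono2) auto
  then show "y \<le> f x" using p assms by (simp add: powr_powr)
next
  assume "y \<le> f x"
  then have "y powr p \<le> f x powr p" using p assms by (intro powr_mono2) auto
  also have "f x powr p = max 0 (1 - x powr p)" unfolding f_def using p by (simp add: powr_powr)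
  finally have "y powr p \<le> max 0 (1 - x powr p)" .
  moreover have "0 < y powr p" using assms by simp
  ultimately show "x powr p + y powr p \<le> 1" by linarith
qed

definition points :: "real \<Rightarrow> real \<Rightarrow> (nat \<times> nat) set" where
  "points r s = {(j, k). 1 \<le> j \<and> 1 \<le> k \<and>
     (real j * s) powr p + (real k * inverse s) powr p \<le> r powr p}"

lemma lattice_count_eq: "lattice_count p r s = card (points r s)"
  by (simp add: lattice_count_def points_def)

lemma points_norm:
  assumes "0 < r" "0 < s"
  shows "(j, k) \<in> points r s \<longleftrightarrow>
    1 \<le> j \<and> 1 \<le> k \<and> (j / (r / s)) powr p + (k / (r * s)) powr p \<le> 1"
proof -
  have "real j * s = r * (j / (r / s))" "real k * inverse s = r * (k / (r * s))"
    using assms by (auto simp: field_simps)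
  then have "(real j * s) powr p + (real k * inverse s) powr p \<le> r powr p \<longleftrightarrow>
      r powr p * ((j / (r / s)) powr p + (k / (r * s)) powr p) \<le> r powr p * 1"
    by (simp only: powr_mult distrib_left mult_1_right)
  also have "\<dots> \<longleftrightarrow> (j / (r / s)) powr p + (k / (r * s)) powr p \<le> 1"
    using assms by (intro mult_le_cancel_left_pos) simp
  finally show ?thesis unfolding points_def by simp
qed

lemma points_iff:
  assumes "0 < r" "0 < s"
  shows "(j, k) \<in> points r s \<longleftrightarrow> 1 \<le> j \<and> 1 \<le> k \<and> k \<le> r * s * f (real j / (r / s))"
proof (cases "1 \<le> k")
  case True
  then have "(j / (r / s)) powr p + (k / (r * s)) powr p \<le> 1 \<longleftrightarrow> k / (r * s) \<le> f (real j / (r / s))"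
    using assms by (intro le_f_iff) auto
  also have "\<dots> \<longleftrightarrow> k \<le> r * s * f (real j / (r / s))" using assms by (simp add: field_simps)
  finally show ?thesis using points_norm[OF assms] by simp
qed (use points_norm[OF assms] in simp)

lemma points_swap: "(j, k) \<in> points r s \<longleftrightarrow> (k, j) \<in> points r (inverse s)"
  by (auto simp: points_def add.commute)

lemma card_points_columns:
  fixes M :: nat
  assumes "0 < r" "0 < s"
  shows "finite {(j, k) \<in> points r s. j \<le> M}"
    and "card {(j, k) \<in> points r s. j \<le> M} = (\<Sum>j=1..M. nat \<lfloor>r * s * f (real j / (r / s))\<rfloor>)"
proof -
  have eq: "{(j, k) \<in> points r s. j \<le> M} = Sigma {1..M} (\<lambda>j. {1..nat \<lfloor>r * s * f (real j / (r / s))\<rfloor>})"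
  proof -
    have "k \<le> nat \<lfloor>r * s * f (real j / (r / s))\<rfloor> \<longleftrightarrow> k \<le> r * s * f (real j / (r / s))" if "1 \<le> k" for j k :: nat
      using that assms f_nonneg[of "j / (r / s)"] by (auto simp: nat_le_iff le_nat_iff le_floor_iff)
    then show ?thesis using points_iff[OF assms] by auto
  qed
  show "finite {(j, k) \<in> points r s. j \<le> M}" unfolding eq by auto
  show "card {(j, k) \<in> points r s. j \<le> M} = (\<Sum>j=1..M. nat \<lfloor>r * s * f (real j / (r / s))\<rfloor>)"
    unfolding eq by (subst card_SigmaI) auto
qed

lemma card_points_rows:
  fixes M :: nat
  assumes "0 < r" "0 < s"
  shows "finite {(j, k) \<in> points r s. k \<le> M}"
    and "card {(j, k) \<in> points r s. k \<le> M} = (\<Sum>k=1..M. nat \<lfloor>r / s * f (real k / (r * s))\<rfloor>)"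
proof -
  have "bij_betw prod.swap {(j, k) \<in> points r (inverse s). j \<le> M} {(j, k) \<in> points r s. k \<le> M}"
    by (rule bij_betw_byWitness[where f' = prod.swap]) (use points_swap[of _ _ r s] points_swap[of _ _ r "inverse s"] in auto)
  then have "card {(j, k) \<in> points r s. k \<le> M} = card {(j, k) \<in> points r (inverse s). j \<le> M}"
    "finite {(j, k) \<in> points r s. k \<le> M} = finite {(j, k) \<in> points r (inverse s). j \<le> M}"
    using bij_betw_same_card bij_betw_finite by fastforce+
  then show "finite {(j, k) \<in> points r s. k \<le> M}"
    and "card {(j, k) \<in> points r s. k \<le> M} = (\<Sum>k=1..M. nat \<lfloor>r / s * f (real k / (r * s))\<rfloor>)"
    using card_points_columns[of r "inverse s" M] assms by (simp_all add: divide_inverse)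
qed

text \<open>Transposing the points; this reduces the theorem to s \<ge> 1.\<close>

lemma lattice_count_inverse: "lattice_count p r (inverse s) = lattice_count p r s"
proof -
  have "bij_betw prod.swap (points r (inverse s)) (points r s)"
    by (rule bij_betw_byWitness[where f' = prod.swap]) (use points_swap[of _ _ r s] points_swap[of _ _ r "inverse s"] in auto)
  then show ?thesis unfolding lattice_count_eq by (rule bij_betw_same_card)
qed

text \<open>The count without the diagonal cut, for the crude estimates, which must also work when r
  / s is small.\<close>

lemma lattice_count_columns:
  assumes "0 < r" "0 < s"
  shows "lattice_count p r s = (\<Sum>j=1..nat \<lfloor>r / s\<rfloor>. nat \<lfloor>r * s * f (real j / (r / s))\<rfloor>)"
proof -
  have "j \<le> nat \<lfloor>r / s\<rfloor>" if "(j, k) \<in> points r s" for j k :: nat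
  proof (rule ccontr)
    assume "\<not> j \<le> nat \<lfloor>r / s\<rfloor>"
    then have "r / s < j" using assms by linarith
    then have "1 \<le> j / (r / s)" using assms by (simp add: field_simps)
    then have "f (real j / (r / s)) \<le> f 1" by (intro f_antimono) auto
    moreover have "f 1 = 0" by (simp add: f_def)
    ultimately have "f (real j / (r / s)) = 0" using f_nonneg[of "j / (r / s)"] by linarith
    then show False using that points_iff[OF assms, of j k] by auto
  qed
  then have "points r s = {(j, k) \<in> points r s. j \<le> nat \<lfloor>r / s\<rfloor>}" by auto
  then have "card (points r s) = card {(j, k) \<in> points r s. j \<le> nat \<lfloor>r / s\<rfloor>}" by (rule arg_cong)
  then show ?thesis unfolding lattice_count_eq card_points_columns(2)[OF assms] .
qed

text \<open>If two nonnegative numbers add up to at most 1, one of them is at most 1/2, so the two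
  strips cover the region. If both are at most 1/2 their sum is at most 1, so the strips meet in the
  whole rectangle.\<close>

lemma lattice_count_split:
  assumes "0 < r" "0 < s"
  defines "m \<equiv> nat \<lfloor>\<alpha> * (r / s)\<rfloor>" and "n \<equiv> nat \<lfloor>\<alpha> * (r * s)\<rfloor>"
  shows "lattice_count p r s + m * n =
    (\<Sum>j=1..m. nat \<lfloor>r * s * f (real j / (r / s))\<rfloor>) + (\<Sum>k=1..n. nat \<lfloor>r / s * f (real k / (r * s))\<rfloor>)"
proof -
  define A where "A = {(j, k) \<in> points r s. j \<le> m}"
  define B where "B = {(j, k) \<in> points r s. k \<le> n}"
  have le: "x powr p \<le> 1 / 2 \<longleftrightarrow> x \<le> \<alpha>" if "0 \<le> x" for x
  proof
    assume "x \<le> \<alpha>"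
    then show "x powr p \<le> 1 / 2" using powr_mono2[of p x \<alpha>] p that \<alpha>_powr by simp
  next
    assume *: "x powr p \<le> 1 / 2"
    show "x \<le> \<alpha>"
    proof (rule ccontr)
      assume "\<not> x \<le> \<alpha>"
      then have "\<alpha> powr p < x powr p" using p \<alpha>_bounds by (intro powr_less_mono2) auto
      then show False using * \<alpha>_powr by simp
    qed
  qed
  have lm: "j \<le> m \<longleftrightarrow> (j / (r / s)) powr p \<le> 1 / 2" for j :: nat
  proof -
    have "j \<le> m \<longleftrightarrow> j \<le> \<alpha> * (r / s)"
      unfolding m_def using assms \<alpha>_bounds by (simp add: le_nat_iff le_floor_iff)
    also have "\<dots> \<longleftrightarrow> j / (r / s) \<le> \<alpha>" using assms by (simp add: field_simps)
    also have "\<dots> \<longleftrightarrow> (j / (r / s)) powr p \<le> 1 / 2" using assms by (intro le[symmetric]) auto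
    finally show ?thesis .
  qed
  have ln: "k \<le> n \<longleftrightarrow> (k / (r * s)) powr p \<le> 1 / 2" for k :: nat
  proof -
    have "k \<le> n \<longleftrightarrow> k \<le> \<alpha> * (r * s)"
      unfolding n_def using assms \<alpha>_bounds by (simp add: le_nat_iff le_floor_iff)
    also have "\<dots> \<longleftrightarrow> k / (r * s) \<le> \<alpha>" using assms by (simp add: field_simps)
    also have "\<dots> \<longleftrightarrow> (k / (r * s)) powr p \<le> 1 / 2" using assms by (intro le[symmetric]) auto
    finally show ?thesis .
  qed
  have "points r s = A \<union> B"
  proof -
    have "j \<le> m \<or> k \<le> n" if "(j, k) \<in> points r s" for j k :: nat
      unfolding lm ln using that points_norm[OF assms(1,2), of j k] by linarith
    then show ?thesis unfolding A_def B_def by auto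
  qed
  moreover have "A \<inter> B = {1..m} \<times> {1..n}"
  proof -
    have "(j, k) \<in> points r s" if "1 \<le> j" "1 \<le> k" "j \<le> m" "k \<le> n" for j k
      using that points_norm[OF assms(1,2), of j k] unfolding lm ln by linarith
    then show ?thesis unfolding A_def B_def by (auto simp: points_def)
  qed
  moreover have "finite A" "finite B"
    unfolding A_def B_def using card_points_columns(1) card_points_rows(1) assms by auto
  ultimately have "card (points r s) + m * n = card A + card B"
    using card_Un_Int[of A B] by simp
  then show ?thesis unfolding lattice_count_eq A_def B_def
    card_points_columns(2)[OF assms(1,2)] card_points_rows(2)[OF assms(1,2)] .
qed

lemma real_nat_floor: "0 \<le> x \<Longrightarrow> real (nat \<lfloor>x\<rfloor>) = x - saw x - 1 / 2"
  by (simp add: saw_def frac_def)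

text \<open>By symmetry this is the integral of \<open>f\<close> over \<open>[0,1]\<close>. The proof never compares the two
  values: \<open>area\<close> and that integral belong to two separate comparisons of \<open>N(r,s)\<close> with \<open>N(r,1)\<close>.\<close>

definition area :: real where "area = 2 * half_area - \<alpha>\<^sup>2"

text \<open>With a and b the fractional parts of \<alpha> R and \<alpha> S, the corrections \<alpha>
  S (1/2 - a) and \<alpha> R (1/2 - b) from \<open>sum_f_asymptotic\<close> cancel against -(m + n)
  / 2 and the linear part of -m n. What remains besides the trapezoidal errors is (a + b) / 2 - a b,
  at most 1 in absolute value.\<close>

lemma main_term:
  fixes R S :: real and m n :: nat
  assumes R: "1 \<le> \<alpha> * R" and S: "1 \<le> \<alpha> * S"
  defines "m \<equiv> nat \<lfloor>\<alpha> * R\<rfloor>" and "n \<equiv> nat \<lfloor>\<alpha> * S\<rfloor>"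
  shows "\<bar>(S * (\<Sum>j=1..m. f (real j / R)) + R * (\<Sum>k=1..n. f (real k / S)) - (real m + real n) / 2 - real m * real n)
      - (area * (R * S) - (R + S) / 2)\<bar> \<le> 1 + 3 / p * (S * R powr (- p) + R * S powr (- p))"
proof -
  define a where "a = \<alpha> * R - m"
  define b where "b = \<alpha> * S - n"
  define F where "F = (\<Sum>j=1..m. f (real j / R))"
  define G where "G = (\<Sum>k=1..n. f (real k / S))"
  define x where "x = F - (R * half_area - 1 / 2 + \<alpha> * (1 / 2 - a))"
  define y where "y = G - (S * half_area - 1 / 2 + \<alpha> * (1 / 2 - b))"
  have pos: "0 < R" "0 < S" 
    using R S \<alpha>_bounds zero_less_mult_pos[of \<alpha> R] zero_less_mult_pos[of \<alpha> S] by linarith+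
  have "real m = of_int \<lfloor>\<alpha> * R\<rfloor>" "real n = of_int \<lfloor>\<alpha> * S\<rfloor>"
    unfolding m_def n_def using R S by (auto intro!: of_nat_nat)
  then have ab: "0 \<le> a" "a \<le> 1" "0 \<le> b" "b \<le> 1" unfolding a_def b_def by linarith+
  have xb: "\<bar>x\<bar> \<le> 3 / p * R powr (- p)"
    unfolding x_def F_def a_def m_def by (rule sum_f_asymptotic[OF R])
  have yb: "\<bar>y\<bar> \<le> 3 / p * S powr (- p)"
    unfolding y_def G_def b_def n_def by (rule sum_f_asymptotic[OF S])
  have m: "real m = \<alpha> * R - a" and n: "real n = \<alpha> * S - b" by (auto simp: a_def b_def)
  have F: "F = R * half_area - 1 / 2 + \<alpha> * (1 / 2 - a) + x" and G: "G = S * half_area - 1 / 2 + \<alpha> * (1 / 2 - b) + y"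
    by (auto simp: x_def y_def)
  have id: "(S * F + R * G - (real m + real n) / 2 - real m * real n) - (area * (R * S) - (R + S) / 2)
      = (a + b) / 2 - a * b + S * x + R * y"
    unfolding F G m n area_def by (simp add: algebra_simps power2_eq_square add_divide_distrib diff_divide_distrib)
  have "0 \<le> a * b" "a * b \<le> 1" using ab by (auto intro!: mult_le_one)
  moreover have "0 \<le> (a + b) / 2" "(a + b) / 2 \<le> 1" using ab by simp_all
  ultimately have "\<bar>(a + b) / 2 - a * b\<bar> \<le> 1" by (simp only: abs_le_iff) linarith
  moreover have "\<bar>S * x\<bar> \<le> S * (3 / p * R powr (- p))" "\<bar>R * y\<bar> \<le> R * (3 / p * S powr (- p))"
    unfolding abs_mult abs_of_pos[OF pos(1)] abs_of_pos[OF pos(2)]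
    using pos by (intro mult_left_mono xb yb; simp)+
  moreover have "3 / p * (S * R powr (- p) + R * S powr (- p)) = S * (3 / p * R powr (- p)) + R * (3 / p * S powr (- p))"
    by (simp add: algebra_simps)
  ultimately show ?thesis unfolding F_def[symmetric] G_def[symmetric] id by linarith
qed

lemma lattice_count_saw:
  fixes r s :: real and m n :: nat
  assumes "0 < r" "0 < s"
  defines "m \<equiv> nat \<lfloor>\<alpha> * (r / s)\<rfloor>" and "n \<equiv> nat \<lfloor>\<alpha> * (r * s)\<rfloor>"
  shows "real (lattice_count p r s) =
    (r * s * (\<Sum>j=1..m. f (real j / (r / s))) + r / s * (\<Sum>k=1..n. f (real k / (r * s)))
       - (real m + real n) / 2 - real m * real n)
    - (\<Sum>j=1..m. saw (r * s * f (real j / (r / s)))) - (\<Sum>k=1..n. saw (r / s * f (real k / (r * s))))"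
proof -
  have fl: "(\<Sum>j=1..m. real (nat \<lfloor>c * g j\<rfloor>)) = c * (\<Sum>j=1..m. g j) - (\<Sum>j=1..m. saw (c * g j)) - real m / 2"
    if "0 \<le> c" "\<And>j. 0 \<le> g j" for c :: real and g :: "nat \<Rightarrow> real" and m :: nat
  proof -
    have "(\<Sum>j=1..m. real (nat \<lfloor>c * g j\<rfloor>)) = (\<Sum>j=1..m. c * g j - saw (c * g j) - 1 / 2)"
      using that by (intro sum.cong refl real_nat_floor mult_nonneg_nonneg)
    then show ?thesis by (simp add: sum_subtractf sum_distrib_left)
  qed
  have "real (lattice_count p r s + m * n) = (\<Sum>j=1..m. real (nat \<lfloor>r * s * f (real j / (r / s))\<rfloor>)) +
      (\<Sum>k=1..n. real (nat \<lfloor>r / s * f (real k / (r * s))\<rfloor>))"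
    unfolding m_def n_def lattice_count_split[OF assms(1,2)] by (simp only: of_nat_add of_nat_sum)
  also have "(\<Sum>j=1..m. real (nat \<lfloor>r * s * f (real j / (r / s))\<rfloor>)) =
     r * s * (\<Sum>j=1..m. f (real j / (r / s))) - (\<Sum>j=1..m. saw (r * s * f (real j / (r / s)))) - real m / 2"
    by (rule fl) (use assms f_nonneg in auto)
  also have "(\<Sum>k=1..n. real (nat \<lfloor>r / s * f (real k / (r * s))\<rfloor>)) =
     r / s * (\<Sum>k=1..n. f (real k / (r * s))) - (\<Sum>k=1..n. saw (r / s * f (real k / (r * s)))) - real n / 2"
    by (rule fl) (use assms f_nonneg in auto)
  finally have tot: "real (lattice_count p r s) + real m * real n =
      (r * s * (\<Sum>j=1..m. f (real j / (r / s))) - (\<Sum>j=1..m. saw (r * s * f (real j / (r / s)))) - real m / 2) +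
      (r / s * (\<Sum>k=1..n. f (real k / (r * s))) - (\<Sum>k=1..n. saw (r / s * f (real k / (r * s)))) - real n / 2)"
    by (simp only: of_nat_add of_nat_mult)
  have lin: "N = (X + Y - (m' + n') / 2 - mn) - SX - SY"
    if "N + mn = (X - SX - m' / 2) + (Y - SY - n' / 2)" for N mn X SX Y SY m' n' :: real
    using that by (simp add: field_simps)
  show ?thesis by (rule lin[OF tot])
qed

lemma sum_saw_ge: "- (real m / 2) \<le> (\<Sum>j=1..m. saw (g j))"
proof -
  have "(\<Sum>j=1..m. - (1 / 2)) \<le> (\<Sum>j=1..m. saw (g j))"
    by (rule sum_mono) (simp add: saw_def)
  then show ?thesis by simp
qed

text \<open>The trivial bound \<open>saw\<close> \<ge> -1/2 costs at most \<alpha> (R + S) / 2 of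
  the linear term (R + S) / 2. Since \<alpha> < 1, a fixed fraction of that term survives, with no
  upper bound on s.\<close>

lemma lattice_count_upper:
  assumes "0 < r" "0 < s" "1 \<le> \<alpha> * (r / s)" "1 \<le> \<alpha> * (r * s)"
  shows "lattice_count p r s \<le> area * r\<^sup>2 - (1 - \<alpha>) / 2 * (r / s + r * s) + 1
    + 3 / p * (r * s * (r / s) powr (- p) + r / s * (r * s) powr (- p))"
proof -
  define m where "m = nat \<lfloor>\<alpha> * (r / s)\<rfloor>"
  define n where "n = nat \<lfloor>\<alpha> * (r * s)\<rfloor>"
  have mn: "real m \<le> \<alpha> * (r / s)" "real n \<le> \<alpha> * (r * s)"
    unfolding m_def n_def using assms by (auto intro!: of_nat_floor)
  have RS: "r / s * (r * s) = r\<^sup>2" using assms by (simp add: power2_eq_square)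
  have e: "(1 - \<alpha>) / 2 * (r / s + r * s) = (r / s + r * s) / 2 - (\<alpha> * (r / s) + \<alpha> * (r * s)) / 2"
    by (simp add: algebra_simps diff_divide_distrib add_divide_distrib)
  have lin: "N \<le> T - (u / 2 - (P + Q) / 2) + 1 + E"
    if "\<bar>X - (m' + n') / 2 - mn - (T - u / 2)\<bar> \<le> 1 + E" "N = X - (m' + n') / 2 - mn - SX - SY"
      "m' \<le> P" "n' \<le> Q" "- (m' / 2) \<le> SX" "- (n' / 2) \<le> SY"
    for N X T u P Q E mn SX SY m' n' :: real
    using that by (simp add: abs_le_iff field_simps)
  show ?thesis unfolding e
    by (rule lin[OF main_term[OF assms(3,4), folded m_def n_def, unfolded RS]
      lattice_count_saw[OF assms(1,2), folded m_def n_def] mn sum_saw_ge sum_saw_ge])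
qed

lemma sum_saw_power:
  fixes R S \<Gamma> :: real and m :: nat
  assumes "0 < S" "1 \<le> \<Gamma>" "S \<le> \<Gamma> * R" "R \<le> \<Gamma> * S" "0 < R" "m \<le> \<alpha> * R"
  shows "\<bar>\<Sum>n=1..m. saw (S * f (real n / R))\<bar> \<le>
    5 * (82 * \<Gamma> * \<kappa> powr (- 2 / 3) + 44 * \<Gamma> * \<kappa> powr (- 1 / 2) + 17) * R powr (2 / 3)"
proof -
  have "\<alpha> * R \<le> 1 * R" using assms \<alpha>_bounds by (intro mult_right_mono) auto
  then have "m \<le> R" using assms by linarith
  then have "R * m \<le> R powr 2" using assms by (simp add: power2_eq_square)
  then have "(R * m) powr (1 / 3) \<le> (R powr 2) powr (1 / 3)" using assms by (intro powr_mono2) auto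
  also have "\<dots> = R powr (2 / 3)" by (simp only: powr_powr) simp
  finally have Z: "(R * m) powr (1 / 3) \<le> R powr (2 / 3)" .
  have "{1..m} = {1..<m + 1}" by auto
  then have "\<bar>\<Sum>n=1..m. saw (S * f (real n / R))\<bar> \<le>
    5 * (82 * \<Gamma> * \<kappa> powr (- 2 / 3) + 44 * \<Gamma> * \<kappa> powr (- 1 / 2) + 17) * (R * m) powr (1 / 3)"
    using saw_sum[OF assms] by simp
  also have "\<dots> \<le> 5 * (82 * \<Gamma> * \<kappa> powr (- 2 / 3) + 44 * \<Gamma> * \<kappa> powr (- 1 / 2) + 17) * R powr (2 / 3)"
    using assms by (intro mult_left_mono Z) auto
  finally show ?thesis .
qed

text \<open>For s in [1, B], both R and S are comparable to r, and their ratios are bounded by B^2,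
  which serves as \<Gamma>. The requirement 2/3 \<le> q covers the sawtooth sums, and 1 - p \<le> q
  the errors S R^(-p) and R S^(-p).\<close>

lemma lattice_count_asymptotic:
  fixes B q :: real
  assumes B: "1 \<le> B" and q: "2 / 3 \<le> q" "1 - p \<le> q"
  shows "\<exists>C>0. \<forall>r s. B \<le> \<alpha> * r \<longrightarrow> 1 \<le> s \<longrightarrow> s \<le> B \<longrightarrow>
    \<bar>lattice_count p r s - (area * r\<^sup>2 - (r / s + r * s) / 2)\<bar> \<le> C * r powr q"
proof -
  define K where "K = 5 * (82 * B\<^sup>2 * \<kappa> powr (- 2 / 3) + 44 * B\<^sup>2 * \<kappa> powr (- 1 / 2) + 17)"
  \<comment> \<open>The summands collect the constant in \<open>main_term\<close>, the two
    trapezoidal errors, and the sawtooth sums over columns and over rows.\<close>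
  define C where "C = 1 + 3 / p * (B\<^sup>2 + 1) + K * (1 + B)"
  have K: "0 \<le> K" unfolding K_def by simp
  have C: "0 < C" unfolding C_def using K B p by (intro add_pos_nonneg) auto
  have main: "\<bar>lattice_count p r s - (area * r\<^sup>2 - (r / s + r * s) / 2)\<bar> \<le> C * r powr q"
    if r: "B \<le> \<alpha> * r" and s: "1 \<le> s" "s \<le> B" for r s
  proof -
    define R where "R = r / s"
    define S where "S = r * s"
    define m where "m = nat \<lfloor>\<alpha> * R\<rfloor>"
    define n where "n = nat \<lfloor>\<alpha> * S\<rfloor>"
    have r0: "0 < r" using r B \<alpha>_bounds zero_less_mult_pos[of \<alpha> r] by linarith
    have "\<alpha> * r \<le> 1 * r" using \<alpha>_bounds r0 by (intro mult_right_mono) auto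
    then have r1: "1 \<le> r" using r B by linarith
    have pos: "0 < R" "0 < S" unfolding R_def S_def using r0 s by auto
    have Rr: "R \<le> r" "r / B \<le> R" unfolding R_def using r0 s B by (auto simp: field_simps)
    have Sr: "r \<le> S" "S \<le> B * r" unfolding S_def using r0 s by (auto simp: mult.commute)
    have aR: "1 \<le> \<alpha> * R" unfolding R_def using r s by (simp add: field_simps)
    have "\<alpha> * r \<le> \<alpha> * S" using Sr \<alpha>_bounds by simp
    then have aS: "1 \<le> \<alpha> * S" using r B by linarith
    have RS: "R * S = r\<^sup>2" unfolding R_def S_def using s by (simp add: power2_eq_square)
    have B2: "1 \<le> B\<^sup>2" using B by simp
    have SR: "S \<le> B\<^sup>2 * R"
    proof -
      have "S = s\<^sup>2 * R" unfolding S_def R_def using s by (simp add: power2_eq_square)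
      also have "\<dots> \<le> B\<^sup>2 * R" using s pos by (intro mult_right_mono power_mono) auto
      finally show ?thesis .
    qed
    have RSl: "R \<le> B\<^sup>2 * S"
    proof -
      have "R \<le> S" using Rr Sr by linarith
      also have "1 * S \<le> B\<^sup>2 * S" using B2 pos by (intro mult_right_mono) auto
      finally show ?thesis by simp
    qed
    have mn: "real m \<le> \<alpha> * R" "real n \<le> \<alpha> * S"
      unfolding m_def n_def using aR aS by (auto intro!: of_nat_floor)
    have P: "r powr (2 / 3) \<le> r powr q" "r powr (1 - p) \<le> r powr q" "1 \<le> r powr q"
      using r1 q by (auto intro!: powr_mono ge_one_powr_ge_zero)
    have s1: "\<bar>\<Sum>j=1..m. saw (S * f (real j / R))\<bar> \<le> K * r powr q"
    proof -
      have "\<bar>\<Sum>j=1..m. saw (S * f (real j / R))\<bar> \<le> K * R powr (2 / 3)"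
        unfolding K_def using sum_saw_power[OF pos(2) B2 SR RSl pos(1) mn(1)] .
      also have "\<dots> \<le> K * r powr q"
        using Rr pos P by (intro mult_left_mono[OF _ K] order.trans[OF powr_mono2 P(1)]) auto
      finally show ?thesis .
    qed
    have s2: "\<bar>\<Sum>k=1..n. saw (R * f (real k / S))\<bar> \<le> K * (B * r powr q)"
    proof -
      have "\<bar>\<Sum>k=1..n. saw (R * f (real k / S))\<bar> \<le> K * S powr (2 / 3)"
        unfolding K_def using sum_saw_power[OF pos(1) B2 RSl SR pos(2) mn(2)] .
      also have "S powr (2 / 3) \<le> (B * r) powr (2 / 3)" using Sr pos by (intro powr_mono2) auto
      also have "(B * r) powr (2 / 3) = B powr (2 / 3) * r powr (2 / 3)" by (rule powr_mult)
      also have "\<dots> \<le> B * r powr q"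
        using B P powr_mono[of "2/3" 1 B] by (intro mult_mono) auto
      finally show ?thesis using K by (simp add: mult_left_mono)
    qed
    have t1: "S * R powr (- p) \<le> B\<^sup>2 * r powr q"
    proof -
      have "S * R powr (- p) \<le> (B * r) * (r / B) powr (- p)"
        using Sr Rr pos r0 B p by (intro mult_mono powr_mono2') auto
      also have "\<dots> = B * B powr p * (r * r powr (- p))"
        using B r0 by (simp add: powr_divide powr_minus_divide)
      also have "r * r powr (- p) = r powr (1 - p)" using r0 by (simp add: powr_mult_base)
      also have "B * B powr p * r powr (1 - p) \<le> B * B * r powr q"
        using B P p powr_mono[of p 1 B] by (intro mult_mono) auto
      finally show ?thesis by (simp add: power2_eq_square)
    qed
    have t2: "R * S powr (- p) \<le> r powr q"
    proof -
      have "R * S powr (- p) \<le> r * r powr (- p)"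
        using Sr Rr pos r0 p by (intro mult_mono powr_mono2') auto
      also have "\<dots> = r powr (1 - p)" using r0 by (simp add: powr_mult_base)
      finally show ?thesis using P by linarith
    qed
    have lin: "\<bar>N - M\<bar> \<le> C'"
      if "E \<le> E'" "C' = q' + E' + K1 + K2" "1 \<le> q'" "\<bar>X - M\<bar> \<le> 1 + E" "N = X - SX - SY"
        "\<bar>SX\<bar> \<le> K1" "\<bar>SY\<bar> \<le> K2"
      for N M C' E E' q' K1 K2 X SX SY :: real
      using that by linarith
    have "3 / p * (S * R powr (- p) + R * S powr (- p)) \<le> 3 / p * (B\<^sup>2 * r powr q + r powr q)"
      using t1 t2 p by (intro mult_left_mono add_mono) auto
    moreover have "C * r powr q = r powr q + 3 / p * (B\<^sup>2 * r powr q + r powr q) + K * r powr q + K * (B * r powr q)"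
      unfolding C_def by (simp add: algebra_simps)
    moreover note P(3)
    ultimately have "\<bar>lattice_count p r s - (area * (R * S) - (R + S) / 2)\<bar> \<le> C * r powr q"
      by (rule lin[OF _ _ _ main_term[OF aR aS, folded m_def n_def]
        lattice_count_saw[OF r0, of s, folded R_def S_def, folded m_def n_def] s1 s2]) (use s in auto)
    then show ?thesis unfolding RS unfolding R_def S_def .
  qed
  show ?thesis by (intro exI[of _ C] conjI C allI impI main)
qed

section \<open>The maximizing stretches\<close>

lemma sum_f_lower: "0 < h \<Longrightarrow> integral {h..real (M + 1) * h} f \<le> h * (\<Sum>j=1..M. f (real j * h))"
proof (induction M)
  case (Suc M)
  have "integral {h..real (Suc M + 1) * h} f =
      integral {h..real (M + 1) * h} f + integral {real (M + 1) * h..real (Suc M + 1) * h} f"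
    using Suc.prems by (intro integral_f_combine) (auto simp: algebra_simps)
  moreover have "integral {real (M + 1) * h..real (Suc M + 1) * h} f \<le> h * f (real (M + 1) * h)"
    using integral_f_bounds(2)[of "real (M + 1) * h" "real (Suc M + 1) * h"] Suc.prems by (simp add: algebra_simps)
  ultimately show ?case using Suc by (simp add: algebra_simps)
qed simp

lemma sum_f_upper:
  assumes "0 < h" "1 \<le> M"
  shows "h * (\<Sum>j=1..M. f (real j * h)) \<le> h * f h + integral {h..real M * h} f"
  using assms(2)
proof (induction M rule: dec_induct)
  case (step M)
  have "integral {h..real (Suc M) * h} f = integral {h..real M * h} f + integral {real M * h..real (Suc M) * h} f"
    using step assms(1) by (intro integral_f_combine) (auto simp: algebra_simps)
  moreover have "h * f (real (Suc M) * h) \<le> integral {real M * h..real (Suc M) * h} f"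
    using integral_f_bounds(1)[of "real M * h" "real (Suc M) * h"] assms(1) by (simp add: algebra_simps)
  ultimately show ?case using step by (simp add: algebra_simps)
qed simp

text \<open>Two losses of at most r each: the strip over [0, 1/r], which the comparison with
  rectangles leaves out, and the floors in at most r columns.\<close>

lemma lattice_count_one_lower:
  assumes "1 \<le> r"
  shows "r\<^sup>2 * integral {0..1} f - 2 * r \<le> lattice_count p r 1"
proof -
  define h where "h = 1 / r"
  define M where "M = nat \<lfloor>r\<rfloor>"
  have h: "0 < h" "h \<le> 1" "r * h = 1" using assms by (auto simp: h_def)
  have M: "real M \<le> r" "r < real (M + 1)" unfolding M_def using assms by linarith+
  have Mh: "1 \<le> real (M + 1) * h" using M assms by (simp add: h_def field_simps)
  have "integral {0..1} f = integral {0..h} f + integral {h..1} f" using h by (intro integral_f_combine) auto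
  moreover have "integral {0..h} f \<le> h" using integral_f_bounds(2)[of 0 h] h f_0 by simp
  moreover have "integral {h..real (M + 1) * h} f = integral {h..1} f + integral {1..real (M + 1) * h} f"
    using h Mh by (intro integral_f_combine) auto
  moreover have "0 \<le> integral {1..real (M + 1) * h} f"
    by (intro integral_nonneg f_integrable f_nonneg) auto
  moreover note sum_f_lower[OF h(1), of M]
  ultimately have "integral {0..1} f - h \<le> h * (\<Sum>j=1..M. f (real j * h))" by linarith
  then have "r\<^sup>2 * (integral {0..1} f - h) \<le> r\<^sup>2 * (h * (\<Sum>j=1..M. f (real j * h)))"
    by (intro mult_left_mono) auto
  also have "\<dots> = r * (\<Sum>j=1..M. f (real j * h))" using assms by (simp add: h_def power2_eq_square)
  also have "r\<^sup>2 * (integral {0..1} f - h) = r\<^sup>2 * integral {0..1} f - r"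
    using assms by (simp add: h_def power2_eq_square right_diff_distrib)
  finally have 1: "r\<^sup>2 * integral {0..1} f - r \<le> r * (\<Sum>j=1..M. f (real j * h))" .
  have "real (lattice_count p r 1) = (\<Sum>j=1..M. real (nat \<lfloor>r * f (real j * h)\<rfloor>))"
    using lattice_count_columns[of r 1] assms by (simp add: M_def h_def)
  moreover have "(\<Sum>j=1..M. r * f (real j * h) - 1) \<le> (\<Sum>j=1..M. real (nat \<lfloor>r * f (real j * h)\<rfloor>))"
    by (intro sum_mono) linarith
  moreover have "(\<Sum>j=1..M. r * f (real j * h) - 1) = r * (\<Sum>j=1..M. f (real j * h)) - M"
    by (simp add: sum_subtractf sum_distrib_left)
  ultimately show ?thesis using 1 M by linarith
qed

text \<open>A lower bound for the area that inscribed columns of width at least \<open>u\<close> lose.\<close>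

definition gap :: "real \<Rightarrow> real" where "gap u = u / 2 * (f (u / 2) - f u)"

lemma gap_pos: "0 < u \<Longrightarrow> u \<le> 1 \<Longrightarrow> 0 < gap u"
  unfolding gap_def using f_strict_antimono[of "u / 2" u] by simp

text \<open>The rectangle of height f h over [0, h] lies below the graph. Over [0, u/2] the graph is
  at least f(u/2) while f h \<le> f u, so an area \<open>gap u\<close> stays uncovered.\<close>

lemma integral_gap:
  assumes "0 < u" "u \<le> h"
  shows "h * f h + gap u \<le> integral {0..h} f"
proof -
  have "integral {0..h} f = integral {0..u / 2} f + integral {u / 2..h} f"
    using assms by (intro integral_f_combine) auto
  moreover have "u / 2 * f (u / 2) \<le> integral {0..u / 2} f" "(h - u / 2) * f h \<le> integral {u / 2..h} f"
    using integral_f_bounds(1)[of 0 "u / 2"] integral_f_bounds(1)[of "u / 2" h] assms by auto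
  moreover have "u / 2 * f h \<le> u / 2 * f u"
    using f_antimono[of u h] assms by (intro mult_left_mono) auto
  moreover have "(h - u / 2) * f h = h * f h - u / 2 * f h" "gap u = u / 2 * f (u / 2) - u / 2 * f u"
    by (simp_all add: gap_def algebra_simps)
  ultimately show ?thesis by linarith
qed

lemma f_1: "f 1 = 0" by (simp add: f_def)

text \<open>Columns have relative width s / r \<ge> u and fit under the graph as inscribed
  rectangles, the first of which loses \<open>gap u\<close>. If r < s there is no column, and only
  \<open>gap u\<close> \<le> the integral has to be checked.\<close>

lemma lattice_count_gap:
  assumes "0 < r" "0 < s" "0 < u" "u \<le> 1" "u * (r / s) \<le> 1"
  shows "lattice_count p r s \<le> r\<^sup>2 * (integral {0..1} f - gap u)"
proof (cases "1 \<le> r / s")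
  case False
  have "gap u \<le> integral {0..1} f" using integral_gap[of u 1] assms f_1 by simp
  moreover have "nat \<lfloor>r / s\<rfloor> = 0" using False by linarith
  then have "lattice_count p r s = 0" unfolding lattice_count_columns[OF assms(1,2)] by simp
  ultimately show ?thesis by simp
next
  case True
  define R where "R = r / s"
  define h where "h = 1 / R"
  define M where "M = nat \<lfloor>R\<rfloor>"
  have R: "1 \<le> R" using True by (simp add: R_def)
  have h: "0 < h" "h \<le> 1" "R * h = 1" using R by (auto simp: h_def)
  have M: "1 \<le> M" "real M \<le> R" unfolding M_def using R by (auto simp: le_nat_iff)
  have Mh: "real M * h \<le> 1" "h \<le> real M * h" using M R by (auto simp: h_def field_simps)
  have u: "u \<le> h" using assms(5) R unfolding R_def[symmetric] by (simp add: h_def field_simps)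
  have "integral {0..1} f = integral {0..h} f + integral {h..1} f" using h by (intro integral_f_combine) auto
  moreover have "integral {h..1} f = integral {h..real M * h} f + integral {real M * h..1} f"
    using h Mh by (intro integral_f_combine) auto
  moreover have "0 \<le> integral {real M * h..1} f"
    using h by (intro integral_nonneg f_integrable f_nonneg) auto
  moreover note integral_gap[OF assms(3) u] sum_f_upper[OF h(1) M(1)]
  ultimately have 1: "h * (\<Sum>j=1..M. f (real j * h)) \<le> integral {0..1} f - gap u" by linarith
  have "real (lattice_count p r s) = (\<Sum>j=1..M. real (nat \<lfloor>r * s * f (real j / R)\<rfloor>))"
    using lattice_count_columns[OF assms(1,2)] by (simp add: M_def R_def)
  also have "\<dots> \<le> (\<Sum>j=1..M. r * s * f (real j / R))"
    using assms f_nonneg by (intro sum_mono of_nat_floor) auto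
  also have "\<dots> = r * s * (\<Sum>j=1..M. f (real j * h))"
    by (simp add: sum_distrib_left h_def)
  also have "\<dots> = r\<^sup>2 * (h * (\<Sum>j=1..M. f (real j * h)))"
    using assms by (simp add: h_def R_def power2_eq_square)
  also have "\<dots> \<le> r\<^sup>2 * (integral {0..1} f - gap u)"
    using 1 by (intro mult_left_mono) auto
  finally show ?thesis .
qed

section \<open>Boundedness and rate for the maximizers\<close>

lemma eventually_power_le_linear:
  fixes C q :: real
  assumes "q < 1" "0 < C"
  shows "\<exists>r0\<ge>1. \<forall>r\<ge>r0. C * r powr q \<le> r"
proof (intro exI[of _ "max 1 (C powr (1 / (1 - q)))"] conjI allI impI)
  fix r assume r: "max 1 (C powr (1 / (1 - q))) \<le> r"
  have "C = (C powr (1 / (1 - q))) powr (1 - q)" using assms by (simp add: powr_powr)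
  also have "\<dots> \<le> r powr (1 - q)" using r assms by (intro powr_mono2) auto
  finally have "C * r powr q \<le> r powr (1 - q) * r powr q" by (intro mult_right_mono) auto
  also have "\<dots> = r" using r by (simp flip: powr_add)
  finally show "C * r powr q \<le> r" .
qed simp

text \<open>If r / s is below a fixed R0, the lost area is a fixed multiple of r^2 and beats the
  loss 2 r at s = 1, which excludes large r. Otherwise \<open>lattice_count_upper\<close> loses a
  multiple of r s, again against a loss of at most 2 r, so s is bounded.\<close>

lemma optimal_bounded:
  shows "\<exists>B r0. 1 \<le> B \<and> 1 \<le> r0 \<and>
    (\<forall>r\<ge>r0. \<forall>s\<ge>1. lattice_count p r 1 \<le> lattice_count p r s \<longrightarrow> s \<le> B)"
proof -
  define q where "q = max (2 / 3) (1 - p)"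
  have q: "2 / 3 \<le> q" "1 - p \<le> q" "q < 1" using p by (auto simp: q_def)
  obtain C where C: "0 < C" and asym: "\<And>r s. 1 \<le> \<alpha> * r \<Longrightarrow> 1 \<le> s \<Longrightarrow> s \<le> 1 \<Longrightarrow>
      \<bar>lattice_count p r s - (area * r\<^sup>2 - (r / s + r * s) / 2)\<bar> \<le> C * r powr q"
    using lattice_count_asymptotic[OF order.refl q(1,2)] by blast
  obtain r1 where r1: "1 \<le> r1" "\<And>r. r1 \<le> r \<Longrightarrow> C * r powr q \<le> r"
    using eventually_power_le_linear[OF q(3) C] by blast
  define b where "b = (1 - \<alpha>) / 2"
  have b: "0 < b" "b \<le> 1" using \<alpha>_bounds by (auto simp: b_def)
  \<comment> \<open>The threshold 1 / \<alpha> secures the hypotheses of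
    \<open>lattice_count_upper\<close>; the other one lets the errors use up at most half of the
    coefficient b.\<close>
  define R0 where "R0 = max (1 / \<alpha>) ((6 / (p * b)) powr (1 / p))"
  have R0: "1 / \<alpha> \<le> R0" "(6 / (p * b)) powr (1 / p) \<le> R0" by (auto simp: R0_def)
  have "1 \<le> 1 / \<alpha>" using \<alpha>_bounds by simp
  then have R01: "1 \<le> R0" using R0 by linarith
  have small: "3 / p * x powr (- p) \<le> b / 2" if "R0 \<le> x" for x
  proof -
    have x: "0 < x" using that R01 by linarith
    have "6 / (p * b) = ((6 / (p * b)) powr (1 / p)) powr p" using p b by (simp add: powr_powr)
    also have "\<dots> \<le> x powr p" using that R0 p by (intro powr_mono2) auto
    finally show ?thesis using x p b by (simp add: powr_minus field_simps)
  qed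
  define \<delta> where "\<delta> = gap (1 / R0)"
  have \<delta>: "0 < \<delta>" unfolding \<delta>_def using R01 by (intro gap_pos) auto
  define r0 where "r0 = max r1 (max R0 (3 / \<delta>))"
  define B where "B = 6 / b"
  have "s \<le> B" if r: "r0 \<le> r" and s: "1 \<le> s" and opt: "lattice_count p r 1 \<le> lattice_count p r s" for r s
  proof -
    have rr: "r1 \<le> r" "R0 \<le> r" "3 / \<delta> \<le> r" "1 \<le> r" using r r1 by (auto simp: r0_def)
    have opt': "real (lattice_count p r 1) \<le> real (lattice_count p r s)" using opt by simp
    show "s \<le> B"
    proof (cases "R0 \<le> r / s")
      case False
      have "real (lattice_count p r s) \<le> r\<^sup>2 * (integral {0..1} f - \<delta>)"
        unfolding \<delta>_def by (rule lattice_count_gap) (use False rr s R01 in \<open>auto simp: field_simps\<close>)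
      then have "r\<^sup>2 * integral {0..1} f - 2 * r \<le> r\<^sup>2 * (integral {0..1} f - \<delta>)"
        using lattice_count_one_lower[OF rr(4)] opt' by linarith
      then have "r * (r * \<delta>) \<le> r * 2" by (simp add: power2_eq_square algebra_simps)
      then have "r * \<delta> \<le> 2" using rr by simp
      moreover have "3 \<le> r * \<delta>" using rr \<delta> by (simp add: field_simps)
      ultimately show ?thesis by simp
    next
      case True
      define R where "R = r / s"
      define S where "S = r * s"
      have RS: "R0 \<le> R" "R \<le> S" "0 < R" "0 < S"
      proof -
        show "R0 \<le> R" using True by (simp add: R_def)
        then show "0 < R" using R01 by linarith
        have "R \<le> r" "r \<le> S" unfolding R_def S_def using rr s by (auto simp: field_simps)
        then show "R \<le> S" "0 < S" using rr by linarith+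
      qed
      have aR: "1 \<le> \<alpha> * R" "1 \<le> \<alpha> * S"
      proof -
        have "1 / \<alpha> \<le> R" "1 / \<alpha> \<le> S" using RS R0 by linarith+
        then show "1 \<le> \<alpha> * R" "1 \<le> \<alpha> * S" using \<alpha>_bounds by (auto simp: field_simps)
      qed
      have "S * (3 / p * R powr (- p)) \<le> S * (b / 2)" "R * (3 / p * S powr (- p)) \<le> R * (b / 2)"
        using RS by (intro mult_left_mono small; linarith)+
      moreover have "3 / p * (S * R powr (- p) + R * S powr (- p)) = S * (3 / p * R powr (- p)) + R * (3 / p * S powr (- p))"
        by (simp add: algebra_simps)
      ultimately have "3 / p * (S * R powr (- p) + R * S powr (- p)) \<le> S * (b / 2) + R * (b / 2)" by linarith
      moreover have "lattice_count p r s \<le> area * r\<^sup>2 - b * (R + S) + 1 + 3 / p * (S * R powr (- p) + R * S powr (- p))"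
        using lattice_count_upper[of r s] aR rr s unfolding b_def R_def S_def by simp
      moreover have "b * (R + S) = S * (b / 2) + R * (b / 2) + b / 2 * R + b / 2 * S" by (simp add: algebra_simps)
      moreover have "0 \<le> b / 2 * R" using b RS by simp
      ultimately have up: "lattice_count p r s \<le> area * r\<^sup>2 - b / 2 * S + 1" by linarith
      have "1 \<le> \<alpha> * r"
      proof -
        have "1 / \<alpha> \<le> r" using R0 rr by linarith
        then show ?thesis using \<alpha>_bounds by (auto simp: field_simps)
      qed
      from asym[OF this, of 1] r1(2)[OF rr(1)] have "area * r\<^sup>2 - 2 * r \<le> lattice_count p r 1" by simp
      \<comment> \<open>The 3 r collects the 2 r lost at s = 1 and the constant 1 \<le> r; this
        yields the bound 6 / b.\<close>
      with up opt' rr have "b / 2 * S \<le> 3 * r" by linarith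
      then have "r * (b * s) \<le> r * 6" unfolding S_def by (simp add: mult_ac)
      then have "b * s \<le> 6" using rr by simp
      then show ?thesis unfolding B_def using b by (simp add: field_simps)
    qed
  qed
  moreover have "1 \<le> B" unfolding B_def using b by (simp add: field_simps)
  moreover have "1 \<le> r0" using r1 by (simp add: r0_def)
  ultimately show ?thesis by blast
qed

text \<open>Comparing the expansions at s and at 1 bounds the excess of r (s + 1/s) over 2 r by a
  multiple of r^(1 - 2 e). The exponents allowed for the error are exactly those with e \<le> 1/6
  and e \<le> p/2.\<close>

lemma maximizer_near_one:
  fixes e :: real
  assumes e: "e \<le> 1 / 6" "e \<le> p / 2"
  shows "\<exists>C r0. 0 < C \<and> 1 \<le> r0 \<and>
    (\<forall>r\<ge>r0. \<forall>s\<ge>1. lattice_count p r 1 \<le> lattice_count p r s \<longrightarrow> \<bar>s - 1\<bar> \<le> C * r powr (- e))"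
proof -
  obtain B r1 where B: "1 \<le> B" "1 \<le> r1"
    and bd: "\<And>r s. r1 \<le> r \<Longrightarrow> 1 \<le> s \<Longrightarrow> lattice_count p r 1 \<le> lattice_count p r s \<Longrightarrow> s \<le> B"
    using optimal_bounded by blast
  define q where "q = 1 - 2 * e"
  have q: "2 / 3 \<le> q" "1 - p \<le> q" using e by (auto simp: q_def)
  obtain C where C: "0 < C" and asym: "\<And>r s. B \<le> \<alpha> * r \<Longrightarrow> 1 \<le> s \<Longrightarrow> s \<le> B \<Longrightarrow>
      \<bar>lattice_count p r s - (area * r\<^sup>2 - (r / s + r * s) / 2)\<bar> \<le> C * r powr q"
    using lattice_count_asymptotic[OF B(1) q] by blast
  define r0 where "r0 = max r1 (B / \<alpha>)"
  have "\<bar>s - 1\<bar> \<le> sqrt (4 * B * C) * r powr (- e)"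
    if r: "r0 \<le> r" and s: "1 \<le> s" and opt: "lattice_count p r 1 \<le> lattice_count p r s" for r s
  proof -
    have rr: "r1 \<le> r" "B / \<alpha> \<le> r" "1 \<le> r" using r B by (auto simp: r0_def)
    have ar: "B \<le> \<alpha> * r" using rr \<alpha>_bounds by (simp add: field_simps)
    have sB: "s \<le> B" using bd rr s opt by blast
    have opt': "real (lattice_count p r 1) \<le> real (lattice_count p r s)" using opt by simp
    have "(r / s + r * s) / 2 \<le> r + 2 * (C * r powr q)"
    proof -
      have "lattice_count p r s - (area * r\<^sup>2 - (r / s + r * s) / 2) \<le> C * r powr q"
        using asym[OF ar s sB] by (rule abs_le_D1)
      moreover have "- (lattice_count p r 1 - (area * r\<^sup>2 - (r / 1 + r * 1) / 2)) \<le> C * r powr q"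
        using asym[OF ar order.refl B(1)] by (rule abs_le_D2)
      moreover have "u / 2 \<le> x + 2 * D"
        if "N - (M - u / 2) \<le> D" "- (N' - (M - (x / 1 + x * 1) / 2)) \<le> D" "N' \<le> N"
        for N N' M D u x :: real
        using that by (simp add: field_simps)
      ultimately show ?thesis using opt' by blast
    qed
    then have "r / s + r * s - 2 * r \<le> 4 * C * r powr q" by simp
    \<comment> \<open>Multiplication by s turns the excess into r (s - 1)^2; the bound s \<le> B
      from \<open>optimal_bounded\<close> pays for it.\<close>
    then have "s * (r / s + r * s - 2 * r) \<le> B * (4 * C * r powr q)"
      using s sB C B by (intro order.trans[OF mult_left_mono mult_right_mono]) auto
    also have "s * (r / s + r * s - 2 * r) = r * (s - 1)\<^sup>2"
      using s by (simp add: power2_eq_square algebra_simps)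
    finally have "r * (s - 1)\<^sup>2 \<le> 4 * B * C * r powr q" by (simp add: mult_ac)
    also have "r powr q = r * (r powr (- e))\<^sup>2"
    proof -
      have "(r powr (- e))\<^sup>2 = r powr (- 2 * e)" by (simp add: power2_eq_square flip: powr_add)
      then show ?thesis using rr powr_mult_base[of r "- 2 * e"] by (simp add: q_def)
    qed
    finally have "r * (s - 1)\<^sup>2 \<le> r * (4 * B * C * (r powr (- e))\<^sup>2)" by (simp add: mult_ac)
    then have "(s - 1)\<^sup>2 \<le> 4 * B * C * (r powr (- e))\<^sup>2" using rr by simp
    then have "sqrt ((s - 1)\<^sup>2) \<le> sqrt (4 * B * C * (r powr (- e))\<^sup>2)" by (rule real_sqrt_le_mono)
    then show ?thesis by (simp add: real_sqrt_mult)
  qed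
  moreover have "0 < sqrt (4 * B * C)" using B C by simp
  moreover have "1 \<le> r0" using B by (simp add: r0_def)
  ultimately show ?thesis by blast
qed

end

theorem mainTheorem3:
  fixes p e :: real
  assumes "0 < p" and "p < 1"
  defines "e \<equiv> min (1 / 6) (p / 2)"
  shows "\<exists>C r0. 0 < C \<and> 0 < r0 \<and>
           (\<forall>r\<ge>r0. \<forall>s\<in>optimal_stretches p r. \<bar>s - 1\<bar> \<le> C * r powr (- e))"
proof -
  interpret p_curve p by unfold_locales (use assms in auto)
  have e: "e \<le> 1 / 6" "e \<le> p / 2" by (auto simp: e_def)
  obtain C r0 where C: "0 < C" "1 \<le> r0" and near: "\<And>r s. r0 \<le> r \<Longrightarrow> 1 \<le> s \<Longrightarrow>
      lattice_count p r 1 \<le> lattice_count p r s \<Longrightarrow> \<bar>s - 1\<bar> \<le> C * r powr (- e)"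
    using maximizer_near_one[OF e] by blast
  have "\<bar>s - 1\<bar> \<le> C * r powr (- e)" if r: "r0 \<le> r" and s: "s \<in> optimal_stretches p r" for r s
  proof -
    have s0: "0 < s" and opt: "lattice_count p r 1 \<le> lattice_count p r s"
      using s by (auto simp: optimal_stretches_def is_arg_max_linorder)
    show ?thesis
    proof (cases "1 \<le> s")
      case True
      then show ?thesis using near r opt by blast
    next
      case False
      \<comment> \<open>Below 1 the reciprocal is also at least as good as s = 1, and it lies at
        least as far from 1 as s does.\<close>
      have t: "1 \<le> inverse s" using False s0 by (simp add: one_le_inverse)
      have "\<bar>s - 1\<bar> \<le> \<bar>inverse s - 1\<bar>"
      proof -
        have "\<bar>s - 1\<bar> = s * \<bar>inverse s - 1\<bar>" using s0 t False by (simp add: right_diff_distrib)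
        also have "\<dots> \<le> 1 * \<bar>inverse s - 1\<bar>" using False by (intro mult_right_mono) auto
        finally show ?thesis by simp
      qed
      also have "\<dots> \<le> C * r powr (- e)"
        by (rule near[OF r t]) (use opt lattice_count_inverse[of r s] in simp)
      finally show ?thesis .
    qed
  qed
  then show ?thesis using C by (intro exI[of _ C] exI[of _ r0]) auto
qed

end
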